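(* Let Assumptions (H1), (H2), (H3) hold and consider the decisions $x_n^k$ and functions $\mathcal{Q}_t^k$ generated by SREDA, with $\lambda_{T,k}=0$ for all $k$ and $\lim_{k\to+\infty}\lambda_{t,k}=0$ for $t=1,\ldots,T-1$. Then: (i) almost surely, for every $t=2,\ldots,T+1$ and every $n\in\mathrm{Nodes}(t-1)$, $\lim_{k\to+\infty}\big(\mathcal{Q}_t(x_n^k)-\mathcal{Q}_t^k(x_n^k)\big)=0$; (ii) almost surely, both sequences $(\bar F_1^{k-1}(x_0,x_{n_1}^k,x_1^{P,k},\xi_1))_k$ and $(\underline{\mathfrak{Q}}_1^k(x_0,\xi_1))_k$ converge to the optimal value $\mathcal{Q}_1(x_0)$; moreover, if $(x_n^* )_{n\in\mathcal{N}}$ is any accumulation point of $((x_n^k)_{n\in\mathcal{N}})_{k\ge1}$ ($\mathcal{N}$ the set of nodes), and $x_t(\xi_1,\ldots,\xi_t):=x_m^*$ where $m$ is the stage-$t$ node whose history of realizations from $n_1$ to $m$ is $(\xi_1,\ldots,\xi_t)$, then $(x_1,\ldots,x_T)$ is an optimal solution of the multistage problem, i.e. for every $t$, every node $n$ of stage $t-1$ and every $m\in C(n)$, $x_m^*$ is an optimal solution of $\inf\{F_t(x_n^*,x_m,\xi_m):x_m\in X_t(x_n^*,\xi_m)\}$ (with $x_{n_0}^*=x_0$).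
   Context: Stages $t=1,\ldots,T$; $x_0\in\mathbb{R}^n$ given, $\mathcal{X}_0:=\{x_0\}$. Random data process $(\xi_t)$: $\xi_1$ deterministic; (H1): $(\xi_t)$ is interstage independent and for $t=2,\ldots,T$, $\xi_t$ is a random vector in $\mathbb{R}^K$ with discrete distribution and finite support $\Theta_t=\{\xi_{t,1},\ldots,\xi_{t,M}\}$. The components of $\xi_t$ include the entries of $(b_t,A_t,B_t)$. For each $t$: $\mathcal{X}_t\subset\mathbb{R}^n$, $f_t(x_{t-1},x_t,\xi_t)\in\mathbb{R}\cup\{+\infty\}$, vector function $g_t(x_{t-1},x_t,\xi_t)$, and $X_t(x_{t-1},\xi_t)=\{x_t\in\mathcal{X}_t: g_t(x_{t-1},x_t,\xi_t)\le0,\ A_tx_t+B_tx_{t-1}=b_t\}$. Dynamic programming: $\mathcal{Q}_{T+1}\equiv0$; $\mathfrak{Q}_t(x_{t-1},\xi_t)=\inf\{F_t(x_{t-1},x_t,\xi_t):=f_t(x_{t-1},x_t,\xi_t)+\mathcal{Q}_{t+1}(x_t): x_t\in X_t(x_{t-1},\xi_t)\}$; $\mathcal{Q}_t(x_{t-1})=\mathbb{E}[\mathfrak{Q}_t(x_{t-1},\xi_t)]$ for $t=2,\ldots,T$; $\mathcal{Q}_1(x_0)=\mathfrak{Q}_1(x_0,\xi_1)$ is the optimal value of the multistage problem. $\mathcal{X}^\varepsilon:=\mathcal{X}+\varepsilon\mathbb{B}_n$ ($\mathbb{B}_n$ closed unit ball). (H2), for $t=1,\ldots,T$: 1) $\mathcal{X}_t$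 nonempty convex compact; 2) for all $x_{t-1},x_t$, $f_t(x_{t-1},x_t,\cdot)$ is measurable and for each $j$, $f_t(\cdot,\cdot,\xi_{t,j})$ is proper convex lsc; 3) for each $j$, each component of $g_t(\cdot,\cdot,\xi_{t,j})$ is convex lsc; 4) there is $\varepsilon>0$ such that for each $j$, $\mathcal{X}_{t-1}^\varepsilon\times\mathcal{X}_t\subset\mathrm{dom}\,f_t(\cdot,\cdot,\xi_{t,j})$ and $X_t(x_{t-1},\xi_{t,j})\neq\emptyset$ for all $x_{t-1}\in\mathcal{X}_{t-1}^\varepsilon$; 5) if $t\ge2$, for each $j$ there is $(\bar y,\bar x)\in(\mathcal{X}_{t-1}\times\mathrm{ri}(\mathcal{X}_t))\cap\mathrm{ri}(\{g_t(\cdot,\cdot,\xi_{t,j})\le0\})$ with $\bar x\in X_t(\bar y,\xi_{t,j})$. Scenario tree: root $n_0$ (stage 0, decision $x_0$) with one child $n_1$ (stage 1, $\xi_{n_1}=\xi_1$); each node of stage $t-1$ ($2\le t\le T$) has $M$ children $m$, one per $\xi_{t,j}$, with realization $\xi_m=\xi_{t,j}$ (containing $A_m,B_m,b_m$) and probability $p_m=\mathbb{P}(\xi_t=\xi_{t,j})$. $\mathrm{Nodes}(t)$ = nodes of stage $t$, $C(n)$ = children of $n$. SREDA: initial $\mathcal{Q}_t^0\le\mathcal{Q}_t$ ($t=2,\ldots,T$; e.g. $\equiv-\infty$), $\mathcal{Q}_{T+1}^k\equiv0$ for all $k$; nonnegative $\lambda_{t,k}$ with $\lambda_{t,1}=\lambda_{T,k}=0$;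 arbitrary prox-centers $x_t^{P,k}\in\mathcal{X}_t$. Iteration $k\ge1$: Forward pass: $x_{n_0}^k=x_0$; for $t=1,\ldots,T$, every node $n$ of stage $t-1$ and every $m\in C(n)$, $x_m^k$ is an optimal solution of $\min\{\bar F_t^{k-1}(x_n^k,x_m,x_t^{P,k},\xi_m):x_m\in X_t(x_n^k,\xi_m)\}$, where $\bar F_t^{k-1}(x_n,x_m,x^P,\xi_m)=f_t(x_n,x_m,\xi_m)+\mathcal{Q}_{t+1}^{k-1}(x_m)+\lambda_{t,k}\|x_m-x^P\|^2$. Backward pass: select nodes $(n_1^k,\ldots,n_T^k)$ with $n_1^k=n_1$ and $n_t^k\in C(n_{t-1}^k)$, corresponding to a sample $(\xi_1^k,\ldots,\xi_T^k)$. For $t=T,\ldots,2$, with $n=n_{t-1}^k$: for each $m\in C(n)$ compute $\underline{\mathfrak{Q}}_t^k(x_n^k,\xi_m)=\inf\{f_t(x_n^k,x_m,\xi_m)+\mathcal{Q}_{t+1}^k(x_m):x_m\in X_t(x_n^k,\xi_m)\}$ and a subgradient $\pi_m^k\in\partial\underline{\mathfrak{Q}}_t^k(\cdot,\xi_m)(x_n^k)$; set $\theta_t^k=\sum_{m\in C(n)}p_m\underline{\mathfrak{Q}}_t^k(x_n^k,\xi_m)$, $\beta_t^k=\sum_{m\in C(n)}p_m\pi_m^k$, cut $\mathcal{C}_t^k(y)=\theta_t^k+\langle\beta_t^k,y-x_n^k\rangle$, and $\mathcal{Q}_t^k=\max\{\mathcal{Q}_t^{k-1},\mathcal{C}_t^k\}$.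 Also $\underline{\mathfrak{Q}}_1^k(x_0,\xi_1)=\inf\{f_1(x_0,x,\xi_1)+\mathcal{Q}_2^k(x):x\in X_1(x_0,\xi_1)\}$. (H3): for every $j=1,\ldots,M$, $t=2,\ldots,T$, $k\ge1$, $\mathbb{P}(\xi_t^k=\xi_{t,j})=\mathbb{P}(\xi_t=\xi_{t,j})>0$, and $\xi_t^k$ is independent of $\sigma(\xi_2^1,\ldots,\xi_T^1,\ldots,\xi_2^{k-1},\ldots,\xi_T^{k-1},\xi_2^k,\ldots,\xi_{t-1}^k)$. *)

theory Defs
  imports "HOL-Analysis.Analysis" "HOL-Probability.Probability"
begin

text \<open>Data of the multistage problem. Realisations of xi_t are indexed by
  j < M (stage t = 2..T) and by j = 0 at stage 1 (xi_1 deterministic).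
  Decisions live in real^'n, equality constraints have 'm rows.\<close>

record ('n, 'm) msp =
  msT :: nat
  msM :: nat
  msx0 :: "real^'n"
  msp :: "nat \<Rightarrow> nat \<Rightarrow> real"
  msX :: "nat \<Rightarrow> (real^'n) set"
  msf :: "nat \<Rightarrow> nat \<Rightarrow> real^'n \<Rightarrow> real^'n \<Rightarrow> ereal"
  msncon :: "nat \<Rightarrow> nat"
  msg :: "nat \<Rightarrow> nat \<Rightarrow> nat \<Rightarrow> real^'n \<Rightarrow> real^'n \<Rightarrow> real"
  msA :: "nat \<Rightarrow> nat \<Rightarrow> real^'n^'m"
  msB :: "nat \<Rightarrow> nat \<Rightarrow> real^'n^'m"
  msb :: "nat \<Rightarrow> nat \<Rightarrow> real^'m"

definition nsc :: "('n::finite, 'm::finite) msp \<Rightarrow> nat \<Rightarrow> nat" where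
  "nsc d t = (if t \<le> 1 then 1 else msM d)"

definition Xst :: "('n::finite, 'm::finite) msp \<Rightarrow> nat \<Rightarrow> (real^'n) set" where
  "Xst d t = (if t = 0 then {msx0 d} else msX d t)"

definition Xset :: "('n::finite, 'm::finite) msp \<Rightarrow> nat \<Rightarrow> real^'n \<Rightarrow> nat \<Rightarrow> (real^'n) set" where
  "Xset d t y j = {x \<in> msX d t. (\<forall>i < msncon d t. msg d t j i y x \<le> 0) \<and>
       msA d t j *v x + msB d t j *v y = msb d t j}"

definition enlarge :: "'a::real_normed_vector set \<Rightarrow> real \<Rightarrow> 'a set" where
  "enlarge S e = {x + u | x u. x \<in> S \<and> norm u \<le> e}"

definition proper_fun :: "('a \<Rightarrow> ereal) \<Rightarrow> bool" where
  "proper_fun \<phi> \<longleftrightarrow> (\<forall>x. \<phi> x \<noteq> -\<infinity>) \<and> (\<exists>x. \<phi> x \<noteq> \<infinity>)"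

definition convex_ext :: "('a::real_vector \<Rightarrow> ereal) \<Rightarrow> bool" where
  "convex_ext \<phi> \<longleftrightarrow> (\<forall>x y u. 0 < u \<and> u < 1 \<longrightarrow>
      \<phi> (u *\<^sub>R x + (1 - u) *\<^sub>R y) \<le> ereal u * \<phi> x + ereal (1 - u) * \<phi> y)"

definition lsc_fun :: "('a::topological_space \<Rightarrow> ereal) \<Rightarrow> bool" where
  "lsc_fun \<phi> \<longleftrightarrow> (\<forall>x c. c < \<phi> x \<longrightarrow> (\<forall>\<^sub>F y in at x. c < \<phi> y))"

text \<open>Exact cost-to-go functions: Qback d i is Q_{T+1-i}.\<close>
primrec Qback :: "('n::finite, 'm::finite) msp \<Rightarrow> nat \<Rightarrow> real^'n \<Rightarrow> ereal" where
  "Qback d 0 = (\<lambda>_. 0)"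
| "Qback d (Suc i) = (\<lambda>y. \<Sum>j<msM d. ereal (msp d (msT d - i) j) *
      (INF z \<in> Xset d (msT d - i) y j. msf d (msT d - i) j y z + Qback d i z))"

definition Qcost :: "('n::finite, 'm::finite) msp \<Rightarrow> nat \<Rightarrow> real^'n \<Rightarrow> ereal" where
  "Qcost d t = Qback d (Suc (msT d) - t)"

definition lowQ :: "('n::finite, 'm::finite) msp \<Rightarrow> (real^'n \<Rightarrow> ereal) \<Rightarrow> nat \<Rightarrow> real^'n \<Rightarrow> nat \<Rightarrow> ereal" where
  "lowQ d Qn t y j = (INF z \<in> Xset d t y j. msf d t j y z + Qn z)"

text \<open>frak Q_t(y, xi_{t,j}); the optimal value is Qfrak d 1 x0 0\<close>
definition Qfrak :: "('n::finite, 'm::finite) msp \<Rightarrow> nat \<Rightarrow> real^'n \<Rightarrow> nat \<Rightarrow> ereal" where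
  "Qfrak d t y j = lowQ d (Qcost d (Suc t)) t y j"

definition H1 :: "('n::finite, 'm::finite) msp \<Rightarrow> bool" where
  "H1 d \<longleftrightarrow> msT d \<ge> 1 \<and> msM d \<ge> 1 \<and>
     (\<forall>t \<in> {2..msT d}. (\<forall>j < msM d. msp d t j > 0) \<and> (\<Sum>j<msM d. msp d t j) = 1)"

definition H2 :: "('n::finite, 'm::finite) msp \<Rightarrow> bool" where
  "H2 d \<longleftrightarrow> (\<forall>t \<in> {1..msT d}.
     (msX d t \<noteq> {} \<and> convex (msX d t) \<and> compact (msX d t))
   \<and> (\<forall>j < nsc d t. proper_fun (\<lambda>(y, x). msf d t j y x) \<and>
        convex_ext (\<lambda>(y, x). msf d t j y x) \<and> lsc_fun (\<lambda>(y, x). msf d t j y x))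
   \<and> (\<forall>j < nsc d t. \<forall>i < msncon d t. convex_on UNIV (\<lambda>(y, x). msg d t j i y x) \<and>
        lsc_fun (\<lambda>(y, x). ereal (msg d t j i y x)))
   \<and> (\<exists>e > 0. \<forall>j < nsc d t.
        enlarge (Xst d (t - 1)) e \<times> msX d t \<subseteq> {(y, x). msf d t j y x < \<infinity>} \<and>
        (\<forall>y \<in> enlarge (Xst d (t - 1)) e. Xset d t y j \<noteq> {}))
   \<and> (t \<ge> 2 \<longrightarrow> (\<forall>j < msM d. \<exists>yb xb.
        (yb, xb) \<in> (msX d (t - 1) \<times> rel_interior (msX d t)) \<inter>
                   rel_interior {(y, x). \<forall>i < msncon d t. msg d t j i y x \<le> 0}
        \<and> xb \<in> Xset d t yb j)))"

text \<open>Scenario tree: a node of stage t \<ge> 1 is the list of realisation indices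
  chosen at stages 2..t (node n_1 = []).\<close>
definition node :: "('n::finite, 'm::finite) msp \<Rightarrow> nat \<Rightarrow> nat list \<Rightarrow> bool" where
  "node d t n \<longleftrightarrow> t \<ge> 1 \<and> length n + 1 = t \<and> set n \<subseteq> {..<msM d}"

text \<open>index j with xi_m = xi_{t,j}\<close>
definition ridx :: "nat list \<Rightarrow> nat" where
  "ridx m = (if m = [] then 0 else last m)"

definition pdec :: "real^'n \<Rightarrow> (nat list \<Rightarrow> real^'n) \<Rightarrow> nat list \<Rightarrow> real^'n" where
  "pdec x0 xs m = (if m = [] then x0 else xs (butlast m))"

definition sample_node :: "(nat \<Rightarrow> nat \<Rightarrow> nat) \<Rightarrow> nat \<Rightarrow> nat \<Rightarrow> nat list" where
  "sample_node s k t = map (s k) [2..<Suc t]"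

definition is_argmin :: "'a set \<Rightarrow> ('a \<Rightarrow> ereal) \<Rightarrow> 'a \<Rightarrow> bool" where
  "is_argmin S \<phi> z \<longleftrightarrow> z \<in> S \<and> (\<forall>z' \<in> S. \<phi> z \<le> \<phi> z')"

definition is_subgrad :: "('a::real_inner \<Rightarrow> ereal) \<Rightarrow> 'a \<Rightarrow> 'a \<Rightarrow> bool" where
  "is_subgrad \<phi> x g \<longleftrightarrow> \<bar>\<phi> x\<bar> \<noteq> \<infinity> \<and> (\<forall>y. \<phi> x + ereal (g \<bullet> (y - x)) \<le> \<phi> y)"

text \<open>One run of SREDA along the sample path s (s k t = index of xi_t^k).
  x k m = x_m^k, xP k t = x_t^{P,k}, pg k t j = pi_m^k for the child m with
  realisation j, Qc k t = Q_t^k.\<close>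
definition sreda_run ::
  "('n::finite, 'm::finite) msp \<Rightarrow> (nat \<Rightarrow> nat \<Rightarrow> real) \<Rightarrow> (nat \<Rightarrow> real^'n \<Rightarrow> ereal)
   \<Rightarrow> (nat \<Rightarrow> nat \<Rightarrow> nat) \<Rightarrow> (nat \<Rightarrow> nat \<Rightarrow> real^'n) \<Rightarrow> (nat \<Rightarrow> nat list \<Rightarrow> real^'n)
   \<Rightarrow> (nat \<Rightarrow> nat \<Rightarrow> nat \<Rightarrow> real^'n) \<Rightarrow> (nat \<Rightarrow> nat \<Rightarrow> real^'n \<Rightarrow> ereal) \<Rightarrow> bool" where
  "sreda_run d lam Q0 s xP x pg Qc \<longleftrightarrow>
     (\<forall>k. Qc k (Suc (msT d)) = (\<lambda>_. 0))
   \<and> (\<forall>t \<in> {2..msT d}. Qc 0 t = Q0 t)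
   \<and> (\<forall>k \<ge> 1. \<forall>t \<in> {1..msT d}. xP k t \<in> msX d t)
   \<and> (\<forall>k \<ge> 1. \<forall>t \<in> {1..msT d}. \<forall>m. node d t m \<longrightarrow>
        is_argmin (Xset d t (pdec (msx0 d) (x k) m) (ridx m))
          (\<lambda>z. msf d t (ridx m) (pdec (msx0 d) (x k) m) z + Qc (k - 1) (Suc t) z
               + ereal (lam t k * (norm (z - xP k t))\<^sup>2))
          (x k m))
   \<and> (\<forall>k \<ge> 1. \<forall>t \<in> {2..msT d}.
        (\<forall>j < msM d. is_subgrad (\<lambda>y. lowQ d (Qc k (Suc t)) t y j)
                         (x k (sample_node s k (t - 1))) (pg k t j))
      \<and> Qc k t = (\<lambda>z. max (Qc (k - 1) t z)
           ((\<Sum>j<msM d. ereal (msp d t j) * lowQ d (Qc k (Suc t)) t (x k (sample_node s k (t - 1))) j)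
            + ereal ((\<Sum>j<msM d. msp d t j *\<^sub>R pg k t j) \<bullet> (z - x k (sample_node s k (t - 1)))))))"

text \<open>indices (i,u) of the samples xi_u^i drawn before xi_t^k\<close>
definition prev :: "nat \<Rightarrow> nat \<Rightarrow> nat \<Rightarrow> (nat \<times> nat) set" where
  "prev T k t = {(i, u). 1 \<le> i \<and> i < k \<and> 2 \<le> u \<and> u \<le> T} \<union> {(i, u). i = k \<and> 2 \<le> u \<and> u < t}"

end

theory Submission
  imports Defs
begin

text \<open>The exact cost-to-go functions are finite and convex, hence continuous, near the compact sets of
  decisions, and this gives uniform bounds on the cuts and their slopes. By optimality of the
  regularised forward step, a cut computed at a trial point is exact up to the gap at the child
  nodes and up to a multiple of \<open>\<lambda>\<^sub>t\<^sub>,\<^sub>k\<close>. By backward induction the cuts at a node are therefore asymptotically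
  exact along the iterations that visit this node, and by compactness only finitely many visited
  trial points can have a large gap with respect to the previous approximation. Independence of the
  samples excludes that a large gap occurs infinitely often but is visited only finitely often.\<close>

text \<open>A backward pass improves the approximations only at trial points on the sampled path,
  whereas the claim concerns every node. The gap is therefore measured against the approximation of
  iteration \<open>k - 1\<close>: together with \<open>x k n\<close> it depends on earlier
  iterations only, while the samples of iteration \<open>k\<close> decide whether \<open>n\<close>
  is visited. The approximation of iteration \<open>k\<close> would already contain the new cut and
  destroy this independence. Nothing is lost, since the approximations increase and stay below the
  exact function. The events of a large gap depend on the whole past, so the Borel--Cantelli lemma
  for independent events does not apply and a conditional form is proved. Measurability of these
  events comes from nonanticipativity: they are determined by finitely many samples with values in
  the natural numbers. Everything else is deterministic and is carried out along one fixed sample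
  path; probability enters through the single property \<open>recurrent\<close>.\<close>

section \<open>Functions that are finite and convex around a set\<close>

text \<open>The cost-to-go functions may be infinite far from the decisions, so finiteness and
  convexity are asked on an open neighbourhood only. Openness gives continuity on \<open>S\<close>
  and room to step out of \<open>S\<close>.\<close>

definition convex_near :: "'a::euclidean_space set \<Rightarrow> ('a \<Rightarrow> ereal) \<Rightarrow> bool" where
  "convex_near S \<phi> \<longleftrightarrow>
     (\<exists>U h. open U \<and> S \<subseteq> U \<and> convex_on U h \<and> (\<forall>y\<in>U. \<phi> y = ereal (h y)))"

text \<open>The bound \<open>M\<close> holds on a closed enlargement of \<open>S\<close>, which is
  compact and still inside \<open>U\<close>. Control slightly outside \<open>S\<close> is what later
  bounds subgradients at points of \<open>S\<close>.\<close>

lemma convex_nearE: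
  assumes "convex_near S \<phi>" "compact S"
  obtains h e M where "continuous_on S h" "\<And>y. y \<in> S \<Longrightarrow> \<phi> y = ereal (h y)" "e > 0"
    "\<And>y u. y \<in> S \<Longrightarrow> norm u \<le> e \<Longrightarrow> \<phi> (y + u) \<le> ereal M"
proof -
  obtain U h where U: "open U" "S \<subseteq> U" "convex_on U h" "\<And>y. y \<in> U \<Longrightarrow> \<phi> y = ereal (h y)"
    using assms(1) unfolding convex_near_def by blast
  have ch: "continuous_on U h" using U(1,3) by (rule convex_on_continuous)
  obtain e where e: "e > 0" "(\<Union>x\<in>S. cball x e) \<subseteq> U"
    using compact_subset_open_imp_cball_epsilon_subset[OF assms(2) U(1,2)] by blast
  let ?C = "{y + u | y u. y \<in> S \<and> u \<in> cball 0 e}"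
  have cC: "compact ?C" by (rule compact_sums[OF assms(2) compact_cball])
  have CU: "?C \<subseteq> U"
  proof
    fix z assume "z \<in> ?C"
    then obtain y u where "z = y + u" "y \<in> S" "norm u \<le> e" by auto
    then have "z \<in> cball y e" "y \<in> S" by (auto simp: dist_norm)
    then show "z \<in> U" using e(2) by blast
  qed
  have "bounded (h ` ?C)"
    by (intro compact_imp_bounded compact_continuous_image[OF continuous_on_subset[OF ch CU] cC])
  then obtain M where M: "\<And>z. z \<in> ?C \<Longrightarrow> \<bar>h z\<bar> \<le> M"
    unfolding bounded_iff by (auto simp: image_iff)
  have "\<phi> (y + u) \<le> ereal M" if "y \<in> S" "norm u \<le> e" for y u
  proof -
    have yu: "y + u \<in> ?C" using that by auto
    then have "\<phi> (y + u) = ereal (h (y + u))" using CU U(4) by blast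
    then show ?thesis using M[OF yu] by simp
  qed
  then show ?thesis
    using that[OF continuous_on_subset[OF ch U(2)] _ e(1)] U(2,4) by blast
qed

lemma convex_near_sum:
  assumes "\<And>j. j < N \<Longrightarrow> convex_near S (\<phi> j)" "\<And>j. j < N \<Longrightarrow> c j \<ge> 0"
  shows "convex_near S (\<lambda>y. \<Sum>j<(N::nat). ereal (c j) * \<phi> j y)"
  using assms
proof (induction N)
  case 0
  show ?case unfolding convex_near_def
    by (rule exI[of _ UNIV], rule exI[of _ "\<lambda>_. 0"]) (simp add: convex_on_def zero_ereal_def)
next
  case (Suc N)
  have "convex_near S (\<lambda>y. \<Sum>j<N. ereal (c j) * \<phi> j y)" using Suc by simp
  then obtain U h where U: "open U" "S \<subseteq> U" "convex_on U h"
      "\<And>y. y \<in> U \<Longrightarrow> (\<Sum>j<N. ereal (c j) * \<phi> j y) = ereal (h y)"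
    unfolding convex_near_def by blast
  have "convex_near S (\<phi> N)" using Suc.prems(1)[of N] by simp
  then obtain V g where V: "open V" "S \<subseteq> V" "convex_on V g" "\<And>y. y \<in> V \<Longrightarrow> \<phi> N y = ereal (g y)"
    unfolding convex_near_def by blast
  have UV: "convex (U \<inter> V)"
    using U(3) V(3) by (intro convex_Int convex_on_imp_convex)
  show ?case unfolding convex_near_def
  proof (intro exI conjI)
    show "open (U \<inter> V)" using U(1) V(1) by blast
    show "S \<subseteq> U \<inter> V" using U(2) V(2) by blast
    show "convex_on (U \<inter> V) (\<lambda>y. h y + c N * g y)"
      using convex_on_subset[OF U(3) _ UV] convex_on_subset[OF V(3) _ UV] Suc.prems(2)[of N]
      by (intro convex_on_add convex_on_cmul) auto
    show "\<forall>y\<in>U \<inter> V. (\<Sum>j<Suc N. ereal (c j) * \<phi> j y) = ereal (h y + c N * g y)"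
      using U(4) V(4) by simp
  qed
qed

section \<open>Lower semicontinuous extended-real functions\<close>

lemma lsc_fun_eventually_nhds:
  assumes "lsc_fun \<phi>" "c < \<phi> x"
  shows "\<forall>\<^sub>F y in nhds x. c < \<phi> y"
  using assms unfolding lsc_fun_def eventually_nhds_conv_at by blast

text \<open>Otherwise a number strictly between \<open>C\<close> and the value at \<open>x\<close>
  would eventually separate the two sides. \<open>C\<close> may be infinite, which the next lemma
  exploits with limit minus infinity.\<close>

lemma lsc_fun_le_lim:
  assumes "lsc_fun \<phi>" "X \<longlonglongrightarrow> x" "c \<longlonglongrightarrow> C"
    and le: "\<forall>\<^sub>F k in sequentially. \<phi> (X k) \<le> c k"
  shows "\<phi> x \<le> C"
proof (rule ccontr)
  assume "\<not> \<phi> x \<le> C"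
  then obtain r where r: "C < r" "r < \<phi> x" using dense[of C "\<phi> x"] by (auto simp: not_le)
  have "\<forall>\<^sub>F k in sequentially. r < \<phi> (X k)"
    using eventually_compose_filterlim[OF lsc_fun_eventually_nhds[OF assms(1) r(2)] assms(2)] .
  moreover have "\<forall>\<^sub>F k in sequentially. c k < r" using assms(3) r(1) by (rule order_tendstoD)
  ultimately have "\<forall>\<^sub>F k in sequentially. False" using le
    by eventually_elim auto
  then show False by simp
qed

lemma lsc_fun_bounded_below_compact:
  fixes \<phi> :: "'a::metric_space \<Rightarrow> ereal"
  assumes "lsc_fun \<phi>" "\<And>x. \<phi> x \<noteq> -\<infinity>" "compact S"
  obtains c where "\<And>x. x \<in> S \<Longrightarrow> ereal c \<le> \<phi> x"
proof -
  have "\<exists>c. \<forall>x\<in>S. ereal c \<le> \<phi> x"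
  proof (rule ccontr)
    assume "\<not> ?thesis"
    then have "\<forall>n::nat. \<exists>x\<in>S. \<phi> x < ereal (- real n)" by (metis not_le)
    then obtain X where X: "\<And>n. X n \<in> S" "\<And>n. \<phi> (X n) < ereal (- real n)" by metis
    obtain x r where r: "strict_mono r" "(X \<circ> r) \<longlonglongrightarrow> x"
      using \<open>compact S\<close> X(1) unfolding compact_def by meson
    have "\<phi> x \<le> - \<infinity>"
    proof (rule lsc_fun_le_lim[OF assms(1) r(2)])
      have "filterlim (\<lambda>k. real (r k)) at_top sequentially"
        using r(1) by (intro filterlim_compose[OF filterlim_real_sequentially filterlim_subseq])
      then have "(\<lambda>k. ereal (real (r k))) \<longlonglongrightarrow> \<infinity>"
        by (simp add: tendsto_PInfty_eq_at_top)
      then show "(\<lambda>k. ereal (- real (r k))) \<longlonglongrightarrow> - \<infinity>"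
        using ereal_Lim_uminus[of "\<lambda>k. ereal (real (r k))" \<infinity>] by simp
      show "\<forall>\<^sub>F k in sequentially. \<phi> ((X \<circ> r) k) \<le> ereal (- real (r k))"
        using X(2) by (simp add: less_imp_le)
    qed
    then show False using assms(2)[of x] by simp
  qed
  then show ?thesis using that by blast
qed

section \<open>Regularity of the exact cost-to-go functions\<close>

locale regular_msp =
  fixes d :: "('n::finite, 'm::finite) msp"
  assumes H1: "H1 d" and H2: "H2 d"
begin

lemma T_ge: "msT d \<ge> 1" and M_ge: "msM d \<ge> 1"
  using H1 unfolding H1_def by blast+

lemma
  assumes "t \<in> {2..msT d}"
  shows prob_pos: "j < msM d \<Longrightarrow> msp d t j > 0" and prob_sum: "(\<Sum>j<msM d. msp d t j) = 1"
  using H1[unfolded H1_def, THEN conjunct2, THEN conjunct2, rule_format, OF assms] by blast+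

lemma
  assumes "t \<in> {1..msT d}"
  shows X_convex: "convex (msX d t)" and X_compact: "compact (msX d t)"
  using bspec[OF H2[unfolded H2_def] assms, THEN conjunct1] by blast+

lemma
  assumes "t \<le> msT d"
  shows Xst_convex: "convex (Xst d t)" and Xst_compact: "compact (Xst d t)"
proof -
  have "convex (Xst d t) \<and> compact (Xst d t)"
  proof (cases "t = 0")
    case False
    then have "t \<in> {1..msT d}" using assms by simp
    then show ?thesis using X_convex X_compact False by (simp add: Xst_def)
  qed (simp add: Xst_def)
  then show "convex (Xst d t)" "compact (Xst d t)" by blast+
qed

lemma
  assumes "t \<in> {1..msT d}" "j < nsc d t"
  shows f_proper: "proper_fun (\<lambda>(y, x). msf d t j y x)"
    and f_convex: "convex_ext (\<lambda>(y, x). msf d t j y x)"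
    and f_lsc: "lsc_fun (\<lambda>(y, x). msf d t j y x)"
  using bspec[OF H2[unfolded H2_def] assms(1), THEN conjunct2, THEN conjunct1] assms(2) by blast+

lemma f_not_MInf:
  assumes "t \<in> {1..msT d}" "j < nsc d t"
  shows "msf d t j y x \<noteq> -\<infinity>"
  using conjunct1[OF f_proper[OF assms, unfolded proper_fun_def], rule_format, of "(y, x)"] by simp

lemma g_convex:
  assumes "t \<in> {1..msT d}" "j < nsc d t" "i < msncon d t"
  shows "convex_on UNIV (\<lambda>(y, x). msg d t j i y x)"
  using bspec[OF H2[unfolded H2_def] assms(1), THEN conjunct2, THEN conjunct2, THEN conjunct1] assms(2,3)
  by blast

lemma feasible_nbhd:
  assumes "t \<in> {1..msT d}"
  obtains e where "e > 0"
    "\<And>j y x. j < nsc d t \<Longrightarrow> y \<in> enlarge (Xst d (t - 1)) e \<Longrightarrow> x \<in> msX d t \<Longrightarrow> msf d t j y x < \<infinity>"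
    "\<And>j y. j < nsc d t \<Longrightarrow> y \<in> enlarge (Xst d (t - 1)) e \<Longrightarrow> Xset d t y j \<noteq> {}"
proof -
  have "\<exists>e > 0. \<forall>j < nsc d t.
        enlarge (Xst d (t - 1)) e \<times> msX d t \<subseteq> {(y, x). msf d t j y x < \<infinity>} \<and>
        (\<forall>y \<in> enlarge (Xst d (t - 1)) e. Xset d t y j \<noteq> {})"
    using bspec[OF H2[unfolded H2_def] assms, THEN conjunct2, THEN conjunct2, THEN conjunct2, THEN conjunct1] .
  then obtain e where e: "e > 0" "\<forall>j < nsc d t.
        enlarge (Xst d (t - 1)) e \<times> msX d t \<subseteq> {(y, x). msf d t j y x < \<infinity>} \<and>
        (\<forall>y \<in> enlarge (Xst d (t - 1)) e. Xset d t y j \<noteq> {})" by blast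
  show ?thesis by (rule that[OF e(1)]) (use e(2) in blast)+
qed

lemma Xset_subset: "Xset d t y j \<subseteq> msX d t"
  by (auto simp: Xset_def)

text \<open>The constraints are jointly convex in the previous and the current decision, so the
  feasible map has a convex graph. This makes the partial minimum in \<open>lowQ\<close>
  convex.\<close>

lemma Xset_convex_comb:
  assumes t: "t \<in> {1..msT d}" "j < nsc d t"
    and z: "z1 \<in> Xset d t y1 j" "z2 \<in> Xset d t y2 j" and u: "0 \<le> u" "u \<le> 1"
  shows "(1 - u) *\<^sub>R z1 + u *\<^sub>R z2 \<in> Xset d t ((1 - u) *\<^sub>R y1 + u *\<^sub>R y2) j"
proof -
  have "msg d t j i ((1 - u) *\<^sub>R y1 + u *\<^sub>R y2) ((1 - u) *\<^sub>R z1 + u *\<^sub>R z2) \<le> 0"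
    if i: "i < msncon d t" for i
  proof -
    have "msg d t j i ((1 - u) *\<^sub>R y1 + u *\<^sub>R y2) ((1 - u) *\<^sub>R z1 + u *\<^sub>R z2)
      \<le> (1 - u) * msg d t j i y1 z1 + u * msg d t j i y2 z2"
      using convex_onD[OF g_convex[OF t i] u, of "(y1, z1)" "(y2, z2)"] by simp
    also have "\<dots> \<le> 0"
      using z i u by (auto simp: Xset_def intro!: add_nonpos_nonpos mult_nonneg_nonpos)
    finally show ?thesis .
  qed
  moreover have "(1 - u) *\<^sub>R z1 + u *\<^sub>R z2 \<in> msX d t"
    using z u convexD_alt[OF X_convex[OF t(1)], of z1 z2 u] by (auto simp: Xset_def)
  moreover have "msA d t j *v ((1 - u) *\<^sub>R z1 + u *\<^sub>R z2) + msB d t j *v ((1 - u) *\<^sub>R y1 + u *\<^sub>R y2)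
      = (1 - u) *\<^sub>R (msA d t j *v z1 + msB d t j *v y1) + u *\<^sub>R (msA d t j *v z2 + msB d t j *v y2)"
    by (simp add: matrix_vector_right_distrib matrix_vector_mult_scaleR scaleR_right_distrib)
  moreover have "\<dots> = msb d t j"
    using z by (simp add: Xset_def flip: scaleR_add_left)
  ultimately show ?thesis by (simp add: Xset_def)
qed

lemma f_bounded_below:
  assumes t: "t \<in> {1..msT d}" "j < nsc d t" and S: "compact S"
  obtains c where "\<And>y x. y \<in> S \<Longrightarrow> x \<in> msX d t \<Longrightarrow> ereal c \<le> msf d t j y x"
proof -
  have "compact (S \<times> msX d t)" using S X_compact[OF t(1)] by (rule compact_Times)
  then obtain c where "\<And>p. p \<in> S \<times> msX d t \<Longrightarrow> ereal c \<le> (\<lambda>(y, x). msf d t j y x) p"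
    using lsc_fun_bounded_below_compact[OF f_lsc[OF t]] f_not_MInf[OF t] by auto
  then show ?thesis using that by force
qed

text \<open>Partial minimisation preserves joint convexity. Finiteness from above comes from
  feasibility and finite costs on an enlargement of the previous decision set, and from below from
  lower semicontinuity of the cost on compact sets.\<close>

lemma lowQ_convex_near:
  assumes t: "t \<in> {1..msT d}" "j < nsc d t" and Q: "convex_near (msX d t) Q"
  shows "convex_near (Xst d (t - 1)) (\<lambda>y. lowQ d Q t y j)"
proof -
  obtain e where e: "e > 0"
    and fin: "\<And>y x. y \<in> enlarge (Xst d (t - 1)) e \<Longrightarrow> x \<in> msX d t \<Longrightarrow> msf d t j y x < \<infinity>"
    and ne: "\<And>y. y \<in> enlarge (Xst d (t - 1)) e \<Longrightarrow> Xset d t y j \<noteq> {}"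
    using feasible_nbhd[OF t(1)] t(2) by metis
  obtain V g where V: "open V" "msX d t \<subseteq> V" "convex_on V g" "\<And>y. y \<in> V \<Longrightarrow> Q y = ereal (g y)"
    using Q unfolding convex_near_def by blast
  have "continuous_on (msX d t) g"
    using convex_on_continuous[OF V(1,3)] V(2) continuous_on_subset by blast
  then have "compact (g ` msX d t)" using X_compact[OF t(1)] compact_continuous_image by blast
  then obtain G where G: "\<And>x. x \<in> msX d t \<Longrightarrow> \<bar>g x\<bar> \<le> G"
    using compact_imp_bounded[of "g ` msX d t"] by (auto simp: bounded_iff)
  \<comment> \<open>The open-ball version of \<open>enlarge\<close>, which uses closed balls; being
    a sum with an open convex ball, it is open and convex.\<close>
  define U where "U = {x + u | x u. x \<in> Xst d (t - 1) \<and> u \<in> ball 0 e}"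
  have Ue: "U \<subseteq> enlarge (Xst d (t - 1)) e" unfolding U_def enlarge_def by (auto intro: less_imp_le)
  have U_eq: "U = (\<Union>x\<in>Xst d (t - 1). \<Union>u\<in>ball 0 e. {x + u})" unfolding U_def by blast
  have U_open: "open U" unfolding U_eq by (intro open_sums) simp
  have tT: "t - 1 \<le> msT d" using t(1) by auto
  have U_convex: "convex U" unfolding U_eq by (intro convex_sums Xst_convex tT convex_ball)
  have XU: "Xst d (t - 1) \<subseteq> U"
  proof
    fix x assume "x \<in> Xst d (t - 1)"
    moreover have "x = x + 0" "0 \<in> ball 0 e" using e by auto
    ultimately show "x \<in> U" unfolding U_def by blast
  qed
  define h where "h y = real_of_ereal (lowQ d Q t y j)" for y
  have h: "lowQ d Q t y j = ereal (h y)" if y: "y \<in> U" for y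
  proof -
    \<comment> \<open>The bound may depend on \<open>y\<close>: only finiteness of the infimum at
      this point is at stake.\<close>
    obtain c where c: "\<And>x. x \<in> msX d t \<Longrightarrow> ereal c \<le> msf d t j y x"
      using f_bounded_below[OF t, of "{y}"] by (metis finite.emptyI finite.insertI finite_imp_compact singletonI)
    have "ereal (c - G) \<le> msf d t j y z + Q z" if "z \<in> Xset d t y j" for z
    proof -
      have z: "z \<in> msX d t" using that Xset_subset by blast
      then have Qz: "Q z = ereal (g z)" using V(2,4) by blast
      have "ereal (- G) \<le> Q z" unfolding Qz using G[OF z] by simp
      then have "ereal c + ereal (- G) \<le> msf d t j y z + Q z" using c[OF z] by (intro add_mono)
      then show ?thesis by simp
    qed
    then have "ereal (c - G) \<le> lowQ d Q t y j" unfolding lowQ_def by (rule INF_greatest)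
    then have low: "lowQ d Q t y j \<noteq> -\<infinity>" by auto
    obtain z where z: "z \<in> Xset d t y j" using ne y Ue by blast
    then have zX: "z \<in> msX d t" using Xset_subset by blast
    have "lowQ d Q t y j \<le> msf d t j y z + Q z" unfolding lowQ_def using z by (rule INF_lower)
    also have "\<dots> < \<infinity>"
    proof -
      have "msf d t j y z < \<infinity>" using fin[of y z] y Ue zX by blast
      moreover have "Q z = ereal (g z)" using V(2,4) zX by blast
      ultimately show ?thesis by (cases "msf d t j y z") auto
    qed
    finally have "lowQ d Q t y j < \<infinity>" .
    then show ?thesis using low unfolding h_def by (cases "lowQ d Q t y j") auto
  qed
  have "convex_on U h"
  proof (rule convex_onI[OF _ U_convex])
    fix u :: real and y1 y2 :: "real^'n" assume u: "0 < u" "u < 1" and y: "y1 \<in> U" "y2 \<in> U"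
    let ?y = "(1 - u) *\<^sub>R y1 + u *\<^sub>R y2"
    have yU: "?y \<in> U" using convexD_alt[OF U_convex y] u by simp
    show "h ?y \<le> (1 - u) * h y1 + u * h y2"
    proof (rule field_le_epsilon)
      fix \<delta> :: real assume \<delta>: "\<delta> > 0"
      \<comment> \<open>Near-minimisers up to \<delta> take the place of minimisers, so attainment
        of the infimum is not an issue.\<close>
      have ex: "\<exists>z\<in>Xset d t w j. msf d t j w z + Q z < ereal (h w + \<delta>)" if "w \<in> U" for w
      proof -
        have "lowQ d Q t w j < ereal (h w + \<delta>)" using h[OF that] \<delta> by simp
        then show ?thesis unfolding lowQ_def INF_less_iff .
      qed
      obtain z1 where z1: "z1 \<in> Xset d t y1 j" "msf d t j y1 z1 + Q z1 < ereal (h y1 + \<delta>)"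
        using ex[OF y(1)] by blast
      obtain z2 where z2: "z2 \<in> Xset d t y2 j" "msf d t j y2 z2 + Q z2 < ereal (h y2 + \<delta>)"
        using ex[OF y(2)] by blast
      have zX: "z1 \<in> msX d t" "z2 \<in> msX d t" using z1 z2 Xset_subset by blast+
      have yU12: "y1 \<in> enlarge (Xst d (t - 1)) e" "y2 \<in> enlarge (Xst d (t - 1)) e" using y Ue by blast+
      obtain f1 where f1: "msf d t j y1 z1 = ereal f1"
        using fin[of y1 z1] f_not_MInf[OF t, of y1 z1] yU12(1) zX by (cases "msf d t j y1 z1") auto
      obtain f2 where f2: "msf d t j y2 z2 = ereal f2"
        using fin[of y2 z2] f_not_MInf[OF t, of y2 z2] yU12(2) zX by (cases "msf d t j y2 z2") auto
      have Q12: "Q z1 = ereal (g z1)" "Q z2 = ereal (g z2)" using V(2,4) zX by auto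
      let ?z = "(1 - u) *\<^sub>R z1 + u *\<^sub>R z2"
      have z: "?z \<in> Xset d t ?y j" using Xset_convex_comb[OF t z1(1) z2(1)] u by simp
      then have "?z \<in> msX d t" using Xset_subset by blast
      then have Qz: "Q ?z = ereal (g ?z)" using V(2,4) by blast
      have gz: "g ?z \<le> (1 - u) * g z1 + u * g z2"
        using convex_onD[OF V(3), of u z1 z2] u zX V(2) by auto
      have "(\<lambda>(y, x). msf d t j y x) ((1 - u) *\<^sub>R (y1, z1) + (1 - (1 - u)) *\<^sub>R (y2, z2))
          \<le> ereal (1 - u) * (\<lambda>(y, x). msf d t j y x) (y1, z1)
            + ereal (1 - (1 - u)) * (\<lambda>(y, x). msf d t j y x) (y2, z2)"
        using f_convex[OF t, unfolded convex_ext_def, rule_format, of "1 - u" "(y1, z1)" "(y2, z2)"] u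
        by simp
      then have fz: "msf d t j ?y ?z \<le> ereal ((1 - u) * f1 + u * f2)" using f1 f2 by simp
      have "ereal (h ?y) \<le> msf d t j ?y ?z + Q ?z"
        unfolding h[OF yU, symmetric] lowQ_def using z by (rule INF_lower)
      also have "\<dots> \<le> ereal ((1 - u) * f1 + u * f2) + ereal ((1 - u) * g z1 + u * g z2)"
        using fz gz Qz by (intro add_mono) auto
      finally have "h ?y \<le> (1 - u) * (f1 + g z1) + u * (f2 + g z2)" by (simp add: algebra_simps)
      also have "\<dots> \<le> (1 - u) * (h y1 + \<delta>) + u * (h y2 + \<delta>)"
        using z1(2) z2(2) f1 f2 Q12 u by (intro add_mono[OF mult_left_mono mult_left_mono]) auto
      finally show "h ?y \<le> (1 - u) * h y1 + u * h y2 + \<delta>" by (simp add: algebra_simps)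
    qed
  qed
  then show ?thesis unfolding convex_near_def using U_open XU h by blast
qed

lemma Qcost_last: "Qcost d (Suc (msT d)) = (\<lambda>_. 0)"
  by (simp add: Qcost_def)

lemma Qcost_eq:
  assumes "t \<in> {1..msT d}"
  shows "Qcost d t y = (\<Sum>j<msM d. ereal (msp d t j) * Qfrak d t y j)"
proof -
  have "Suc (msT d) - t = Suc (msT d - t)" "msT d - (msT d - t) = t" using assms by auto
  then show ?thesis using assms by (simp add: Qcost_def Qfrak_def lowQ_def)
qed

text \<open>Both claims go through one backward induction: \<open>Qcost\<close> at
  \<open>Suc t\<close> gives \<open>Qfrak\<close> at \<open>t\<close>, whose average is
  \<open>Qcost\<close> at \<open>t\<close>. The guards cut off the ends, where only one of the two
  is meaningful: \<open>Qcost\<close> after the last stage, \<open>Qfrak\<close> at the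
  first.\<close>

lemma Qfrak_Qcost_convex_near:
  assumes "t \<in> {1..Suc (msT d)}"
  shows "(t \<le> msT d \<longrightarrow> (\<forall>j<nsc d t. convex_near (Xst d (t - 1)) (\<lambda>y. Qfrak d t y j))) \<and>
    (t \<ge> 2 \<longrightarrow> convex_near (msX d (t - 1)) (Qcost d t))"
proof -
  have "t \<le> Suc (msT d)" using assms by simp
  then show ?thesis using assms
  proof (induction t rule: inc_induct)
    case base
    have "convex_near S (Qcost d (Suc (msT d)))" for S
      unfolding convex_near_def Qcost_last
      by (rule exI[of _ UNIV], rule exI[of _ "\<lambda>_. 0"]) (simp add: convex_on_def zero_ereal_def)
    then show ?case by simp
  next
    case (step t)
    have t: "t \<in> {1..msT d}" using step by auto
    have "convex_near (msX d t) (Qcost d (Suc t))" using step.IH t by simp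
    then have q: "\<And>j. j < nsc d t \<Longrightarrow> convex_near (Xst d (t - 1)) (\<lambda>y. Qfrak d t y j)"
      unfolding Qfrak_def using lowQ_convex_near t by blast
    have "convex_near (msX d (t - 1)) (Qcost d t)" if t2: "t \<ge> 2"
    proof -
      have "Xst d (t - 1) = msX d (t - 1)" "nsc d t = msM d" using t2 by (auto simp: Xst_def nsc_def)
      then have "convex_near (msX d (t - 1)) (\<lambda>y. \<Sum>j<msM d. ereal (msp d t j) * Qfrak d t y j)"
        using q prob_pos t t2 by (intro convex_near_sum) (auto intro: less_imp_le)
      moreover have "Qcost d t = (\<lambda>y. \<Sum>j<msM d. ereal (msp d t j) * Qfrak d t y j)"
        using Qcost_eq[OF t] by blast
      ultimately show ?thesis by simp
    qed
    then show ?case using q by blast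
  qed
qed

lemma Qfrak_convex_near:
  "t \<in> {1..msT d} \<Longrightarrow> j < nsc d t \<Longrightarrow> convex_near (Xst d (t - 1)) (\<lambda>y. Qfrak d t y j)"
  using Qfrak_Qcost_convex_near[of t] by auto

lemma Qcost_convex_near:
  "t \<in> {2..Suc (msT d)} \<Longrightarrow> convex_near (msX d (t - 1)) (Qcost d t)"
  using Qfrak_Qcost_convex_near[of t] by auto

lemma Qcost_finite:
  assumes "t \<in> {2..Suc (msT d)}"
  obtains h where "continuous_on (msX d (t - 1)) h"
    "\<And>z. z \<in> msX d (t - 1) \<Longrightarrow> Qcost d t z = ereal (h z)"
proof -
  have "t - 1 \<in> {1..msT d}" using assms by auto
  then show ?thesis using convex_nearE[OF Qcost_convex_near[OF assms] X_compact] that by metis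
qed

end

section \<open>Stage problems, tree nodes and gaps\<close>

lemma is_argmin_mem: "is_argmin S \<phi> z \<Longrightarrow> z \<in> S"
  by (simp add: is_argmin_def)

lemma lowQ_mono:
  assumes "\<And>z. z \<in> msX d t \<Longrightarrow> Q z \<le> Q' z"
  shows "lowQ d Q t y j \<le> lowQ d Q' t y j"
  unfolding lowQ_def using assms by (intro INF_mono) (auto simp: Xset_def intro: add_left_mono)

lemma lowQ_le: "z \<in> Xset d t y j \<Longrightarrow> lowQ d Q t y j \<le> msf d t j y z + Q z"
  unfolding lowQ_def by (rule INF_lower)

text \<open>\<open>r\<close> is real, so it can be moved across the inequality even where the
  infimum is infinite.\<close>

lemma le_lowQ_add:
  assumes "\<And>z. z \<in> Xset d t y j \<Longrightarrow> c \<le> msf d t j y z + Q z + ereal r"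
  shows "c \<le> lowQ d Q t y j + ereal r"
proof -
  have "c - ereal r \<le> lowQ d Q t y j"
    unfolding lowQ_def using assms by (intro INF_greatest) (simp add: ereal_minus_le)
  then show ?thesis by (simp add: ereal_minus_le)
qed

lemma node_childI: "node d (t - 1) n \<Longrightarrow> j < msM d \<Longrightarrow> node d t (n @ [j])"
  by (auto simp: node_def)

lemma node_pdec: "pdec x0 xs (n @ [j]) = xs n" "ridx (n @ [j]) = j"
  by (simp_all add: pdec_def ridx_def)

text \<open>The additive form avoids an extended-real difference, since the initial approximation
  may be minus infinity. The index \<open>k - 1\<close> keeps the property independent of the
  samples of iteration \<open>k\<close>.\<close>

definition gap_le :: "('n::finite, 'm::finite) msp \<Rightarrow> (nat \<Rightarrow> nat list \<Rightarrow> real^'n) \<Rightarrow>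
    (nat \<Rightarrow> nat \<Rightarrow> real^'n \<Rightarrow> ereal) \<Rightarrow> nat \<Rightarrow> nat list \<Rightarrow> real \<Rightarrow> nat \<Rightarrow> bool" where
  "gap_le d x Qc t n \<epsilon> k \<longleftrightarrow> Qcost d t (x k n) \<le> Qc (k - 1) t (x k n) + ereal \<epsilon>"

lemma tendsto_ereal_epsI:
  assumes "\<And>\<epsilon>. \<epsilon> > 0 \<Longrightarrow> \<forall>\<^sub>F k in F. a k \<le> ereal (v + \<epsilon>) \<and> ereal v \<le> a k + ereal \<epsilon>"
  shows "(a \<longlongrightarrow> ereal v) F"
proof (rule order_tendstoI)
  fix l assume "l < ereal v"
  then obtain u where u: "l < ereal u" "ereal u < ereal v" using ereal_dense2 by blast
  have "\<forall>\<^sub>F k in F. a k \<le> ereal (v + (v - u)) \<and> ereal v \<le> a k + ereal (v - u)"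
    using u by (intro assms) simp
  then show "\<forall>\<^sub>F k in F. l < a k"
  proof eventually_elim
    case (elim k)
    then have "ereal u \<le> a k" by (cases "a k") auto
    with u(1) show ?case by (rule less_le_trans)
  qed
next
  fix l assume "ereal v < l"
  then obtain u where u: "ereal v < ereal u" "ereal u < l" using ereal_dense2 by blast
  have "\<forall>\<^sub>F k in F. a k \<le> ereal (v + (u - v)) \<and> ereal v \<le> a k + ereal (u - v)"
    using u by (intro assms) simp
  then show "\<forall>\<^sub>F k in F. a k < l"
    using u by (auto elim!: eventually_mono intro: le_less_trans)
qed

section \<open>One run along a fixed sample path: validity of the cuts\<close>

locale sreda_path = regular_msp d
  for d :: "('n::finite, 'm::finite) msp" +
  fixes lam :: "nat \<Rightarrow> nat \<Rightarrow> real" and Q0 :: "nat \<Rightarrow> real^'n \<Rightarrow> ereal"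
    and s :: "nat \<Rightarrow> nat \<Rightarrow> nat" and xP :: "nat \<Rightarrow> nat \<Rightarrow> real^'n"
    and x :: "nat \<Rightarrow> nat list \<Rightarrow> real^'n"
    and pg :: "nat \<Rightarrow> nat \<Rightarrow> nat \<Rightarrow> real^'n" and Qc :: "nat \<Rightarrow> nat \<Rightarrow> real^'n \<Rightarrow> ereal"
  assumes s_range: "k \<ge> 1 \<Longrightarrow> t \<in> {2..msT d} \<Longrightarrow> s k t < msM d"
    and lam_nonneg: "lam t k \<ge> 0"
    and lam_lim: "t \<in> {1..msT d} \<Longrightarrow> lam t \<longlonglongrightarrow> 0"
    and Q0_le: "t \<in> {2..msT d} \<Longrightarrow> Q0 t z \<le> Qcost d t z"
    and run: "sreda_run d lam Q0 s xP x pg Qc"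
begin

lemmas run_parts = run[unfolded sreda_run_def]

lemma Qc_last: "Qc k (Suc (msT d)) = (\<lambda>_. 0)"
  using run_parts[THEN conjunct1] by blast

lemma Qc_0: "t \<in> {2..msT d} \<Longrightarrow> Qc 0 t = Q0 t"
  using run_parts[THEN conjunct2, THEN conjunct1] by blast

lemma xP_in: "k \<ge> 1 \<Longrightarrow> t \<in> {1..msT d} \<Longrightarrow> xP k t \<in> msX d t"
  using run_parts[THEN conjunct2, THEN conjunct2, THEN conjunct1] by blast

lemma x_argmin:
  assumes "k \<ge> 1" "t \<in> {1..msT d}" "node d t m"
  shows "is_argmin (Xset d t (pdec (msx0 d) (x k) m) (ridx m))
          (\<lambda>z. msf d t (ridx m) (pdec (msx0 d) (x k) m) z + Qc (k - 1) (Suc t) z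
               + ereal (lam t k * (norm (z - xP k t))\<^sup>2))
          (x k m)"
  using run_parts[THEN conjunct2, THEN conjunct2, THEN conjunct2, THEN conjunct1] assms by blast

abbreviation trial :: "nat \<Rightarrow> nat \<Rightarrow> real^'n" where
  "trial k t \<equiv> x k (sample_node s k (t - 1))"

lemma pg_subgrad:
  assumes "k \<ge> 1" "t \<in> {2..msT d}" "j < msM d"
  shows "is_subgrad (\<lambda>y. lowQ d (Qc k (Suc t)) t y j) (trial k t) (pg k t j)"
  using run_parts[THEN conjunct2, THEN conjunct2, THEN conjunct2, THEN conjunct2] assms by blast

text \<open>Taking real parts loses nothing for \<open>k \<ge> 1\<close> at stages \<open>2\<close>
  to \<open>msT d\<close>: \<open>is_subgrad\<close> includes finiteness at the trial point.\<close>

definition theta :: "nat \<Rightarrow> nat \<Rightarrow> real" where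
  "theta k t = (\<Sum>j<msM d. msp d t j * real_of_ereal (lowQ d (Qc k (Suc t)) t (trial k t) j))"

definition beta :: "nat \<Rightarrow> nat \<Rightarrow> real^'n" where
  "beta k t = (\<Sum>j<msM d. msp d t j *\<^sub>R pg k t j)"

lemma lowQ_trial:
  assumes "k \<ge> 1" "t \<in> {2..msT d}" "j < msM d"
  shows "lowQ d (Qc k (Suc t)) t (trial k t) j
      = ereal (real_of_ereal (lowQ d (Qc k (Suc t)) t (trial k t) j))"
  using pg_subgrad[OF assms] unfolding is_subgrad_def by (simp add: ereal_real')

lemma theta_eq:
  assumes "k \<ge> 1" "t \<in> {2..msT d}"
  shows "(\<Sum>j<msM d. ereal (msp d t j) * lowQ d (Qc k (Suc t)) t (trial k t) j) = ereal (theta k t)"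
proof -
  have "(\<Sum>j<msM d. ereal (msp d t j) * lowQ d (Qc k (Suc t)) t (trial k t) j)
      = (\<Sum>j<msM d. ereal (msp d t j * real_of_ereal (lowQ d (Qc k (Suc t)) t (trial k t) j)))"
    by (rule sum.cong[OF refl], subst lowQ_trial[OF assms]) auto
  then show ?thesis by (simp add: theta_def)
qed

lemma Qc_cut:
  assumes "k \<ge> 1" "t \<in> {2..msT d}"
  shows "Qc k t z = max (Qc (k - 1) t z) (ereal (theta k t + beta k t \<bullet> (z - trial k t)))"
proof -
  have "Qc k t = (\<lambda>z. max (Qc (k - 1) t z)
           ((\<Sum>j<msM d. ereal (msp d t j) * lowQ d (Qc k (Suc t)) t (trial k t) j)
            + ereal ((\<Sum>j<msM d. msp d t j *\<^sub>R pg k t j) \<bullet> (z - trial k t))))"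
    using run_parts[THEN conjunct2, THEN conjunct2, THEN conjunct2, THEN conjunct2] assms by blast
  from fun_cong[OF this, of z] show ?thesis
    unfolding theta_eq[OF assms] beta_def[symmetric] by simp
qed

lemma cut_le_Qc:
  assumes "k \<ge> 1" "t \<in> {2..msT d}"
  shows "ereal (theta k t + beta k t \<bullet> (z - trial k t)) \<le> Qc k t z"
  unfolding Qc_cut[OF assms] by simp

lemma Qc_mono:
  assumes "k \<le> k'" "t \<in> {2..Suc (msT d)}"
  shows "Qc k t z \<le> Qc k' t z"
  using assms(1)
proof (induction k' rule: dec_induct)
  case (step k')
  have "Qc k' t z \<le> Qc (Suc k') t z"
  proof (cases "t = Suc (msT d)")
    case False
    then show ?thesis using assms(2) Qc_cut[of "Suc k'" t z] by simp
  qed (simp add: Qc_last)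
  then show ?case using step.IH by simp
qed simp

lemma sample_node_node:
  assumes "k \<ge> 1" "t \<in> {1..msT d}"
  shows "node d t (sample_node s k t)"
  using assms s_range[of k] by (auto simp: node_def sample_node_def)

lemma x_Xset:
  assumes "k \<ge> 1" "t \<in> {1..msT d}" "node d t m"
  shows "x k m \<in> Xset d t (pdec (msx0 d) (x k) m) (ridx m)"
  using is_argmin_mem[OF x_argmin[OF assms]] .

lemma x_in:
  assumes "k \<ge> 1" "t \<in> {1..msT d}" "node d t m"
  shows "x k m \<in> msX d t"
  using x_Xset[OF assms] Xset_subset by blast

lemma trial_in:
  assumes "k \<ge> 1" "t \<in> {2..msT d}"
  shows "trial k t \<in> msX d (t - 1)"
proof -
  have "t - 1 \<in> {1..msT d}" using assms by auto
  then show ?thesis using x_in sample_node_node assms(1) by blast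
qed

text \<open>A cut is an average of affine minorants of the stage values computed with the next-stage
  approximation, which lies below the exact one. That approximation belongs to the same iteration,
  hence the downward induction on \<open>t\<close> inside the induction on \<open>k\<close>.\<close>

lemma Qc_le_Qcost:
  assumes "t \<in> {2..Suc (msT d)}"
  shows "Qc k t z \<le> Qcost d t z"
  using assms
proof (induction k arbitrary: t z)
  case 0
  show ?case
  proof (cases "t = Suc (msT d)")
    case False
    then show ?thesis using 0 Q0_le[of t z] Qc_0[of t] by simp
  qed (simp add: Qc_last Qcost_last)
next
  case (Suc k)
  have "t \<le> Suc (msT d)" using Suc.prems by simp
  then show ?case using Suc.prems
  proof (induction t arbitrary: z rule: inc_induct)
    case base
    then show ?case by (simp add: Qc_last Qcost_last)
  next
    case (step t)
    have t: "t \<in> {2..msT d}" "t \<in> {1..msT d}" "Suc t \<in> {2..Suc (msT d)}" using step by auto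
    let ?q = "\<lambda>y j. lowQ d (Qc (Suc k) (Suc t)) t y j" and ?y = "trial (Suc k) t"
    have "ereal (theta (Suc k) t + beta (Suc k) t \<bullet> (z - ?y))
        = (\<Sum>j<msM d. ereal (msp d t j) * ereal (real_of_ereal (?q ?y j) + pg (Suc k) t j \<bullet> (z - ?y)))"
      by (simp add: theta_def beta_def inner_sum_left sum.distrib[symmetric] distrib_left)
    also have "\<dots> \<le> (\<Sum>j<msM d. ereal (msp d t j) * Qfrak d t z j)"
    proof (intro sum_mono ereal_mult_left_mono)
      fix j assume "j \<in> {..<msM d}"
      then have j: "j < msM d" by simp
      then show "0 \<le> ereal (msp d t j)" using prob_pos[OF t(1) j] by simp
      have "ereal (real_of_ereal (?q ?y j) + pg (Suc k) t j \<bullet> (z - ?y))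
          = ?q ?y j + ereal (pg (Suc k) t j \<bullet> (z - ?y))"
        by (subst (2) lowQ_trial[OF _ t(1) j]) auto
      also have "\<dots> \<le> ?q z j"
        using pg_subgrad[of "Suc k" t j] t(1) j unfolding is_subgrad_def by simp
      also have "\<dots> \<le> Qfrak d t z j"
        unfolding Qfrak_def by (intro lowQ_mono step.IH t(3))
      finally show "ereal (real_of_ereal (?q ?y j) + pg (Suc k) t j \<bullet> (z - ?y)) \<le> Qfrak d t z j" .
    qed
    also have "\<dots> = Qcost d t z" using Qcost_eq[OF t(2)] by simp
    finally show ?case
      using Suc.IH[of t z] t(1) Qc_cut[of "Suc k" t z] by simp
  qed
qed

lemma lowQ_Qc_le_Qfrak:
  assumes "t \<in> {1..msT d}"
  shows "lowQ d (Qc k (Suc t)) t y j \<le> Qfrak d t y j"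
  unfolding Qfrak_def using assms by (intro lowQ_mono Qc_le_Qcost) auto

section \<open>Near-optimality of the regularised forward step\<close>

abbreviation Dsq :: "nat \<Rightarrow> real" where
  "Dsq t \<equiv> (diameter (msX d t))\<^sup>2"

lemma dist_sq_le_Dsq:
  assumes "t \<in> {1..msT d}" "z \<in> msX d t" "w \<in> msX d t"
  shows "(norm (z - w))\<^sup>2 \<le> Dsq t"
proof -
  have "norm (z - w) \<le> diameter (msX d t)"
    using diameter_bounded_bound[OF compact_imp_bounded[OF X_compact[OF assms(1)]] assms(2,3)]
    by (simp add: dist_norm)
  then show ?thesis by (simp add: power_mono)
qed

lemma lam_Dsq_lim: "t \<in> {1..msT d} \<Longrightarrow> (\<lambda>k. lam t k * Dsq t) \<longlonglongrightarrow> 0"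
  using tendsto_mult_right[OF lam_lim, of t "Dsq t"] by simp

text \<open>Any feasible competitor pays a proximal penalty of at most
  \<open>lam t k * Dsq t\<close>, because it and the prox-centre lie in the same compact
  set.\<close>

lemma forward_le_lowQ:
  assumes k: "k \<ge> 1" "t \<in> {1..msT d}" "node d t m"
  shows "msf d t (ridx m) (pdec (msx0 d) (x k) m) (x k m) + Qc (k - 1) (Suc t) (x k m)
      + ereal (lam t k * (norm (x k m - xP k t))\<^sup>2)
    \<le> lowQ d (Qc (k - 1) (Suc t)) t (pdec (msx0 d) (x k) m) (ridx m) + ereal (lam t k * Dsq t)"
proof (rule le_lowQ_add)
  fix z assume z: "z \<in> Xset d t (pdec (msx0 d) (x k) m) (ridx m)"
  have "lam t k * (norm (z - xP k t))\<^sup>2 \<le> lam t k * Dsq t"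
    using z Xset_subset xP_in[OF k(1,2)] dist_sq_le_Dsq[OF k(2)]
    by (intro mult_left_mono lam_nonneg) blast
  then show "msf d t (ridx m) (pdec (msx0 d) (x k) m) (x k m) + Qc (k - 1) (Suc t) (x k m)
      + ereal (lam t k * (norm (x k m - xP k t))\<^sup>2)
    \<le> msf d t (ridx m) (pdec (msx0 d) (x k) m) z + Qc (k - 1) (Suc t) z + ereal (lam t k * Dsq t)"
    using x_argmin[OF k, unfolded is_argmin_def, THEN conjunct2, rule_format, OF z]
    by (elim order_trans) (intro add_left_mono, simp)
qed

lemma forward_exact_le_lowQ:
  assumes k: "k \<ge> 1" "t \<in> {1..msT d}" "node d t m"
    and gap: "Qcost d (Suc t) (x k m) \<le> Qc (k - 1) (Suc t) (x k m) + ereal \<delta>"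
  shows "msf d t (ridx m) (pdec (msx0 d) (x k) m) (x k m) + Qcost d (Suc t) (x k m)
    \<le> lowQ d (Qc (k - 1) (Suc t)) t (pdec (msx0 d) (x k) m) (ridx m) + ereal (lam t k * Dsq t + \<delta>)"
proof -
  let ?f = "msf d t (ridx m) (pdec (msx0 d) (x k) m) (x k m)"
  have "?f + Qcost d (Suc t) (x k m) \<le> ?f + Qc (k - 1) (Suc t) (x k m) + ereal \<delta>"
    using add_left_mono[OF gap, of ?f] by (simp add: add.assoc)
  also have "\<dots> \<le> ?f + Qc (k - 1) (Suc t) (x k m)
      + ereal (lam t k * (norm (x k m - xP k t))\<^sup>2) + ereal \<delta>"
    using lam_nonneg[of t k] by (intro add_right_mono) (simp add: ereal_le_add_self)
  also have "\<dots> \<le> lowQ d (Qc (k - 1) (Suc t)) t (pdec (msx0 d) (x k) m) (ridx m)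
      + ereal (lam t k * Dsq t) + ereal \<delta>"
    by (intro add_right_mono forward_le_lowQ k)
  finally show ?thesis by (simp add: add.assoc)
qed

text \<open>The forward decision is feasible for the exact problem as well. A small gap at a node
  thus carries over to the stage value at its parent.\<close>

lemma Qfrak_le_lowQ:
  assumes k: "k \<ge> 1" "t \<in> {1..msT d}" "node d t m"
    and gap: "Qcost d (Suc t) (x k m) \<le> Qc (k - 1) (Suc t) (x k m) + ereal \<delta>"
  shows "Qfrak d t (pdec (msx0 d) (x k) m) (ridx m)
    \<le> lowQ d (Qc (k - 1) (Suc t)) t (pdec (msx0 d) (x k) m) (ridx m) + ereal (lam t k * Dsq t + \<delta>)"
  unfolding Qfrak_def
  using lowQ_le[OF x_Xset[OF k]] forward_exact_le_lowQ[OF k gap] by (rule order_trans)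

section \<open>Uniform bounds on cuts and slopes\<close>

text \<open>A subgradient at a trial point cannot be steep: a step of length \<open>e\<close> along
  it stays below the bound \<open>M\<close> on \<open>Qfrak\<close>, while the value at the trial
  point is at least \<open>c + b\<close>.\<close>

lemma cut_bounds:
  assumes t: "t \<in> {2..msT d}"
    and b: "\<And>k z. k \<ge> 1 \<Longrightarrow> z \<in> msX d t \<Longrightarrow> ereal b \<le> Qc k (Suc t) z"
  obtains L c where "\<And>k. k \<ge> 1 \<Longrightarrow> norm (beta k t) \<le> L" "\<And>k. k \<ge> 1 \<Longrightarrow> c \<le> theta k t"
proof -
  have t1: "t \<in> {1..msT d}" "t - 1 \<in> {1..msT d}" using t by auto
  have X: "Xst d (t - 1) = msX d (t - 1)" using t by (simp add: Xst_def)
  have "\<exists>L c. \<forall>k\<ge>1. norm (pg k t j) \<le> L \<and> c \<le> real_of_ereal (lowQ d (Qc k (Suc t)) t (trial k t) j)"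
    if j: "j < msM d" for j
  proof -
    have j': "j < nsc d t" using j t by (simp add: nsc_def)
    obtain c where c: "\<And>y z. y \<in> msX d (t - 1) \<Longrightarrow> z \<in> msX d t \<Longrightarrow> ereal c \<le> msf d t j y z"
      by (rule f_bounded_below[OF t1(1) j' X_compact[OF t1(2)]], rule that)
    obtain e M where e: "e > 0"
      and M: "\<And>y u. y \<in> msX d (t - 1) \<Longrightarrow> norm u \<le> e \<Longrightarrow> Qfrak d t (y + u) j \<le> ereal M"
      by (rule convex_nearE[OF Qfrak_convex_near[OF t1(1) j', unfolded X] X_compact[OF t1(2)]], rule that)
    have "norm (pg k t j) \<le> \<bar>M - (c + b)\<bar> / e \<and>
        c + b \<le> real_of_ereal (lowQ d (Qc k (Suc t)) t (trial k t) j)" if k: "k \<ge> 1" for k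
    proof -
      let ?q = "\<lambda>y. lowQ d (Qc k (Suc t)) t y j" and ?y = "trial k t" and ?g = "pg k t j"
      have "ereal (c + b) \<le> ?q ?y"
        unfolding lowQ_def
      proof (rule INF_greatest)
        fix z assume "z \<in> Xset d t ?y j"
        then have z: "z \<in> msX d t" using Xset_subset by blast
        have "ereal c + ereal b \<le> msf d t j ?y z + Qc k (Suc t) z"
          by (intro add_mono c b k z trial_in t)
        then show "ereal (c + b) \<le> msf d t j ?y z + Qc k (Suc t) z" by simp
      qed
      then have low: "c + b \<le> real_of_ereal (?q ?y)"
        by (subst (asm) lowQ_trial[OF k t j]) simp
      \<comment> \<open>A step of length \<open>e\<close> in the direction of the subgradient; if
        that is zero, division by zero makes \<open>u\<close> zero.\<close>
      define u where "u = (e / norm ?g) *\<^sub>R ?g"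
      have u: "norm u \<le> e" using e by (simp add: u_def)
      have "?q ?y + ereal (?g \<bullet> (?y + u - ?y)) \<le> ?q (?y + u)"
        using pg_subgrad[OF k t j] unfolding is_subgrad_def by blast
      also have "\<dots> \<le> ereal M"
        using lowQ_Qc_le_Qfrak[OF t1(1)] M[OF trial_in[OF k t] u] by (rule order_trans)
      finally have "real_of_ereal (?q ?y) + ?g \<bullet> u \<le> M"
        by (subst (asm) lowQ_trial[OF k t j]) simp
      moreover have "?g \<bullet> u = e * norm ?g"
        by (cases "?g = 0") (simp_all add: u_def dot_square_norm power2_eq_square)
      ultimately have "e * norm ?g \<le> \<bar>M - (c + b)\<bar>" using low by linarith
      then show ?thesis using low e by (simp add: pos_le_divide_eq mult.commute)
    qed
    then show ?thesis by blast
  qed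
  then obtain L c where Lc: "\<And>j k. j < msM d \<Longrightarrow> k \<ge> 1 \<Longrightarrow> norm (pg k t j) \<le> L j"
    "\<And>j k. j < msM d \<Longrightarrow> k \<ge> 1 \<Longrightarrow> c j \<le> real_of_ereal (lowQ d (Qc k (Suc t)) t (trial k t) j)"
    by metis
  have p: "\<And>j. j < msM d \<Longrightarrow> 0 \<le> msp d t j" using prob_pos[OF t] by (simp add: less_imp_le)
  show ?thesis
  proof (rule that)
    fix k :: nat assume k: "k \<ge> 1"
    show "norm (beta k t) \<le> (\<Sum>j<msM d. msp d t j * L j)"
      unfolding beta_def using Lc(1)[OF _ k] p
      by (intro sum_norm_le) (simp add: mult_left_mono)
    show "(\<Sum>j<msM d. msp d t j * c j) \<le> theta k t"
      unfolding theta_def using Lc(2)[OF _ k] p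
      by (intro sum_mono mult_left_mono) auto
  qed
qed

text \<open>Backward induction: bounds at the next stage control height and slope of the cuts at
  this stage, and one cut bounds the approximation from below on a bounded set. The bound starts at
  \<open>k = 1\<close>, after the first cut, since the initial approximation may be minus
  infinity.\<close>

lemma Qc_bounded_below:
  assumes "t \<in> {2..Suc (msT d)}"
  shows "\<exists>b. \<forall>k\<ge>1. \<forall>z\<in>msX d (t - 1). ereal b \<le> Qc k t z"
proof -
  have "t \<le> Suc (msT d)" using assms by simp
  then show ?thesis using assms
  proof (induction t rule: inc_induct)
    case base
    then show ?case by (intro exI[of _ 0]) (simp add: Qc_last)
  next
    case (step t)
    have t: "t \<in> {2..msT d}" "t - 1 \<in> {1..msT d}" using step by auto
    obtain b where "\<And>k z. k \<ge> 1 \<Longrightarrow> z \<in> msX d t \<Longrightarrow> ereal b \<le> Qc k (Suc t) z"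
      using step.IH t by auto
    then obtain L c where L: "\<And>k. k \<ge> 1 \<Longrightarrow> norm (beta k t) \<le> L"
      and c: "\<And>k. k \<ge> 1 \<Longrightarrow> c \<le> theta k t"
      using cut_bounds[OF t(1)] by blast
    have "ereal (c - L * diameter (msX d (t - 1))) \<le> Qc k t z"
      if k: "k \<ge> 1" and z: "z \<in> msX d (t - 1)" for k z
    proof -
      have "norm (z - trial k t) \<le> diameter (msX d (t - 1))"
        using diameter_bounded_bound[OF compact_imp_bounded[OF X_compact[OF t(2)]] z trial_in[OF k t(1)]]
        by (simp add: dist_norm)
      then have "norm (beta k t) * norm (z - trial k t) \<le> L * diameter (msX d (t - 1))"
        using L[OF k] order_trans[OF norm_ge_zero L[OF k]] by (intro mult_mono) simp_all
      then have "c - L * diameter (msX d (t - 1)) \<le> theta k t + beta k t \<bullet> (z - trial k t)"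
        using Cauchy_Schwarz_ineq2[of "beta k t" "z - trial k t"] c[OF k] by linarith
      then show ?thesis using cut_le_Qc[OF k t(1), of z] by (metis ereal_less_eq(3) order_trans)
    qed
    then show ?case by blast
  qed
qed

lemma cut_slope_bounded:
  assumes "t \<in> {2..msT d}"
  obtains L where "L > 0" "\<And>k. k \<ge> 1 \<Longrightarrow> norm (beta k t) \<le> L"
proof -
  obtain b where "\<And>k z. k \<ge> 1 \<Longrightarrow> z \<in> msX d t \<Longrightarrow> ereal b \<le> Qc k (Suc t) z"
    using Qc_bounded_below[of "Suc t"] assms by auto
  then obtain L where "\<And>k. k \<ge> 1 \<Longrightarrow> norm (beta k t) \<le> L"
    using cut_bounds[OF assms] by blast
  \<comment> \<open>Positivity of the bound allows the tolerance \<epsilon>\<open>/ (3 * L)\<close>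
    later.\<close>
  then show ?thesis using that[of "max L 1"] by fastforce
qed

section \<open>Asymptotic exactness at visited nodes\<close>

abbreviation small_gap :: "nat \<Rightarrow> nat list \<Rightarrow> real \<Rightarrow> nat \<Rightarrow> bool" where
  "small_gap \<equiv> gap_le d x Qc"

text \<open>Half of the tolerance absorbs the gaps at the children, half the proximal penalty;
  averaging keeps the error because the probabilities sum to one.\<close>

lemma theta_approx:
  assumes t: "t \<in> {2..msT d}" and n: "node d (t - 1) n" and \<epsilon>: "\<epsilon> > 0"
    and gap: "\<And>m \<delta>. node d t m \<Longrightarrow> \<delta> > 0 \<Longrightarrow> eventually (small_gap (Suc t) m \<delta>) sequentially"
  shows "\<forall>\<^sub>F k in sequentially. sample_node s k (t - 1) = n \<longrightarrow>
    Qcost d t (x k n) \<le> ereal (theta k t + \<epsilon>)"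
proof -
  have t1: "t \<in> {1..msT d}" using t by auto
  have "\<forall>\<^sub>F k in sequentially. \<forall>j\<in>{..<msM d}. small_gap (Suc t) (n @ [j]) (\<epsilon> / 2) k"
    using gap node_childI[OF n] \<epsilon> by (intro eventually_ball_finite) auto
  moreover have "\<forall>\<^sub>F k in sequentially. lam t k * Dsq t < \<epsilon> / 2"
    using order_tendstoD(2)[OF lam_Dsq_lim[OF t1], of "\<epsilon> / 2"] \<epsilon> by simp
  ultimately show ?thesis using eventually_ge_at_top[of 1]
  proof eventually_elim
    case (elim k)
    show ?case
    proof
      assume n_eq: "sample_node s k (t - 1) = n"
      let ?q = "\<lambda>j. real_of_ereal (lowQ d (Qc k (Suc t)) t (trial k t) j)"
      have "Qfrak d t (x k n) j \<le> ereal (?q j + \<epsilon>)" if j: "j < msM d" for j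
      proof -
        have "Qfrak d t (x k n) j
            \<le> lowQ d (Qc (k - 1) (Suc t)) t (x k n) j + ereal (lam t k * Dsq t + \<epsilon> / 2)"
          using Qfrak_le_lowQ[OF elim(3) t1 node_childI[OF n j], of "\<epsilon> / 2"] elim(1) j
          by (simp add: gap_le_def node_pdec)
        \<comment> \<open>The forward step used the old next-stage approximation and the cut uses
          the new one, which is larger.\<close>
        also have "\<dots> \<le> lowQ d (Qc k (Suc t)) t (x k n) j + ereal \<epsilon>"
          using elim(2) t by (intro add_mono lowQ_mono Qc_mono) auto
        also have "\<dots> = ereal (?q j + \<epsilon>)"
          using lowQ_trial[OF elim(3) t j] unfolding n_eq by (metis plus_ereal.simps(1))
        finally show ?thesis .
      qed
      then have "Qcost d t (x k n) \<le> (\<Sum>j<msM d. ereal (msp d t j) * ereal (?q j + \<epsilon>))"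
        unfolding Qcost_eq[OF t1] using prob_pos[OF t]
        by (intro sum_mono ereal_mult_left_mono) (auto intro: less_imp_le)
      also have "\<dots> = ereal (theta k t + (\<Sum>j<msM d. msp d t j) * \<epsilon>)"
        by (simp add: theta_def sum.distrib distrib_left sum_distrib_right)
      finally show "Qcost d t (x k n) \<le> ereal (theta k t + \<epsilon>)" by (simp add: prob_sum[OF t])
    qed
  qed
qed

text \<open>Among infinitely many trial points in a compact set there are two close ones \<open>x k n\<close> and
  \<open>x k' n\<close> with \<open>k < k'\<close>; the cut computed at the former is nearly exact also at the latter.\<close>
lemma finite_sampled_large_gaps:
  assumes t: "t \<in> {2..msT d}" and n: "node d (t - 1) n" and \<epsilon>: "\<epsilon> > 0"
    and gap: "\<And>m \<delta>. node d t m \<Longrightarrow> \<delta> > 0 \<Longrightarrow> eventually (small_gap (Suc t) m \<delta>) sequentially"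
  shows "finite {k. sample_node s k (t - 1) = n \<and> \<not> small_gap t n \<epsilon> k}" (is "finite ?K")
proof (rule ccontr)
  assume inf: "infinite ?K"
  have t': "t - 1 \<in> {1..msT d}" "t \<in> {2..Suc (msT d)}" using t by auto
  obtain h where h: "continuous_on (msX d (t - 1)) h"
    "\<And>z. z \<in> msX d (t - 1) \<Longrightarrow> Qcost d t z = ereal (h z)"
    by (rule Qcost_finite[OF t'(2)], rule that)
  obtain L where L: "L > 0" "\<And>k. k \<ge> 1 \<Longrightarrow> norm (beta k t) \<le> L"
    by (rule cut_slope_bounded[OF t], rule that)
  have "\<forall>\<^sub>F k in sequentially. sample_node s k (t - 1) = n \<longrightarrow>
      Qcost d t (x k n) \<le> ereal (theta k t + \<epsilon> / 3)"
    using theta_approx[OF t n _ gap] \<epsilon> by simp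
  then obtain k0 where k0: "\<And>k. k \<ge> k0 \<Longrightarrow> sample_node s k (t - 1) = n \<Longrightarrow>
      Qcost d t (x k n) \<le> ereal (theta k t + \<epsilon> / 3)"
    unfolding eventually_sequentially by blast
  define K where "K = ?K - {..max 1 k0}"
  have "infinite K" unfolding K_def using inf by (intro Diff_infinite_finite) auto
  define e where "e = enumerate K"
  have eK: "e i \<in> K" for i unfolding e_def using \<open>infinite K\<close> by (rule enumerate_in_set)
  have e_mono: "strict_mono e" unfolding e_def using \<open>infinite K\<close> by (rule strict_mono_enumerate)
  have e1: "e i \<ge> 1" "e i \<ge> k0" "sample_node s (e i) (t - 1) = n" "\<not> small_gap t n \<epsilon> (e i)" for i
    using eK[of i] unfolding K_def by auto
  have ex: "x (e i) n \<in> msX d (t - 1)" for i using x_in[OF e1(1) t'(1) n] .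
  obtain l r where l: "l \<in> msX d (t - 1)" and r: "strict_mono r"
    and lim: "(\<lambda>i. x (e (r i)) n) \<longlonglongrightarrow> l"
  proof -
    have "\<forall>i. x (e i) n \<in> msX d (t - 1)" using ex by blast
    then show thesis
      using X_compact[OF t'(1)] that unfolding compact_def o_def by meson
  qed
  have "(\<lambda>i. h (x (e (r i)) n)) \<longlonglongrightarrow> h l"
    using continuous_on_tendsto_compose[OF h(1) lim l] ex by simp
  then have "(\<lambda>i. h (x (e (r (Suc i))) n) - h (x (e (r i)) n)) \<longlonglongrightarrow> h l - h l"
    by (intro tendsto_diff LIMSEQ_Suc)
  then have hlim: "\<forall>\<^sub>F i in sequentially. h (x (e (r (Suc i))) n) - h (x (e (r i)) n) < \<epsilon> / 3"
    using \<epsilon> by (intro order_tendstoD) auto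
  have "(\<lambda>i. norm (x (e (r (Suc i))) n - x (e (r i)) n)) \<longlonglongrightarrow> norm (l - l)"
    using lim by (intro tendsto_norm tendsto_diff LIMSEQ_Suc)
  \<comment> \<open>Multiplied by the slope bound \<open>L\<close>, this distance costs one third of
    the tolerance.\<close>
  then have "\<forall>\<^sub>F i in sequentially. norm (x (e (r (Suc i))) n - x (e (r i)) n) < \<epsilon> / (3 * L)"
    using \<epsilon> L(1) by (intro order_tendstoD) auto
  with hlim have "\<forall>\<^sub>F i in sequentially. h (x (e (r (Suc i))) n) - h (x (e (r i)) n) < \<epsilon> / 3 \<and>
      norm (x (e (r (Suc i))) n - x (e (r i)) n) < \<epsilon> / (3 * L)"
    by eventually_elim simp
  then obtain i where i: "h (x (e (r (Suc i))) n) - h (x (e (r i)) n) < \<epsilon> / 3"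
      "norm (x (e (r (Suc i))) n - x (e (r i)) n) < \<epsilon> / (3 * L)"
    unfolding eventually_sequentially by blast
  define k k' where "k = e (r i)" and "k' = e (r (Suc i))"
  have "k < k'" unfolding k_def k'_def using e_mono r by (simp add: strict_mono_less)
  have k: "k \<ge> 1" "trial k t = x k n" "x k n \<in> msX d (t - 1)" "x k' n \<in> msX d (t - 1)"
    using e1 ex by (auto simp: k_def k'_def)
  \<comment> \<open>The error splits into three thirds: inexactness of the cut at
    \<open>x k n\<close>, variation of the exact function between the two points, and slope of the
    cut times their distance.\<close>
  have th: "h (x k n) \<le> theta k t + \<epsilon> / 3"
    using k0[of k] e1 h(2)[OF k(3)] by (simp add: k_def)
  have "norm (beta k t) * norm (x k' n - x k n) \<le> L * (\<epsilon> / (3 * L))"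
    using L(2)[OF k(1)] L(1) i(2) by (intro mult_mono) (auto simp: k_def k'_def)
  then have "- (\<epsilon> / 3) \<le> beta k t \<bullet> (x k' n - x k n)"
    using Cauchy_Schwarz_ineq2[of "beta k t" "x k' n - x k n"] L(1) by simp
  then have "h (x k' n) \<le> theta k t + beta k t \<bullet> (x k' n - trial k t) + \<epsilon>"
    using th i(1) k(2) by (simp add: k_def k'_def)
  then have "ereal (h (x k' n)) \<le> ereal (theta k t + beta k t \<bullet> (x k' n - trial k t)) + ereal \<epsilon>"
    by simp
  also have "\<dots> \<le> Qc k t (x k' n) + ereal \<epsilon>"
    by (intro add_right_mono cut_le_Qc k t)
  \<comment> \<open>As \<open>k < k'\<close>, the cut of iteration \<open>k\<close> is already part
    of the approximation of iteration \<open>k' - 1\<close>.\<close>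
  also have "\<dots> \<le> Qc (k' - 1) t (x k' n) + ereal \<epsilon>"
    using \<open>k < k'\<close> by (intro add_right_mono Qc_mono t') simp
  finally have "small_gap t n \<epsilon> k'" unfolding gap_le_def h(2)[OF k(4)] .
  then show False using e1(4) unfolding k'_def by blast
qed

end

text \<open>The sampling property that holds almost surely: a node at which the gap is large infinitely
  often is also visited infinitely often at iterations with a large gap.\<close>
locale sreda_good_path = sreda_path +
  assumes recurrent: "t \<in> {2..msT d} \<Longrightarrow> node d (t - 1) n \<Longrightarrow>
    infinite {k. \<not> small_gap t n (1 / Suc i) k} \<Longrightarrow>
    infinite {k. sample_node s k (t - 1) = n \<and> \<not> small_gap t n (1 / Suc i) k}"
begin

section \<open>Convergence along a good sample path\<close>

text \<open>Backward over stages: small gaps at all children leave only finitely many visited large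
  gaps, and by \<open>recurrent\<close> then only finitely many large gaps at all.\<close>

lemma eventually_small_gap:
  assumes "t \<in> {2..Suc (msT d)}" "node d (t - 1) n" "\<epsilon> > 0"
  shows "eventually (small_gap t n \<epsilon>) sequentially"
proof -
  have "t \<le> Suc (msT d)" using assms(1) by simp
  then show ?thesis using assms
  proof (induction t arbitrary: n \<epsilon> rule: inc_induct)
    case base
    then show ?case by (simp add: gap_le_def Qcost_last Qc_last zero_ereal_def)
  next
    case (step t)
    have t: "t \<in> {2..msT d}" using step by auto
    \<comment> \<open>\<open>recurrent\<close> speaks of the tolerances \<open>1 / Suc i\<close>
      only, so that countably many almost sure events suffice.\<close>
    obtain i where i: "1 / real (Suc i) < \<epsilon>" using nat_approx_posE[OF \<open>\<epsilon> > 0\<close>] by blast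
    have "finite {k. \<not> small_gap t n (1 / Suc i) k}"
      using recurrent[OF t step.prems(2), of i]
        finite_sampled_large_gaps[OF t step.prems(2), of "1 / Suc i"] step.IH t by auto
    then have "eventually (small_gap t n (1 / Suc i)) sequentially"
      by (simp add: eventually_cofinite flip: cofinite_eq_sequentially)
    then show ?case
    proof eventually_elim
      case (elim k)
      have "Qc (k - 1) t (x k n) + ereal (1 / Suc i) \<le> Qc (k - 1) t (x k n) + ereal \<epsilon>"
        using i by (intro add_left_mono) simp
      then show ?case using elim unfolding gap_le_def by (rule order_trans[rotated])
    qed
  qed
qed

lemma gap_lim:
  assumes t: "t \<in> {2..Suc (msT d)}" "node d (t - 1) n"
  shows "(\<lambda>k. Qcost d t (x k n) - Qc k t (x k n)) \<longlonglongrightarrow> 0"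
proof -
  have t1: "t - 1 \<in> {1..msT d}" using t by auto
  obtain h where h: "\<And>z. z \<in> msX d (t - 1) \<Longrightarrow> Qcost d t z = ereal (h z)"
    by (rule Qcost_finite[OF t(1)], rule that)
  have "(\<lambda>k. Qcost d t (x k n) - Qc k t (x k n)) \<longlonglongrightarrow> ereal 0"
  proof (rule tendsto_ereal_epsI)
    fix \<epsilon> :: real assume "\<epsilon> > 0"
    show "\<forall>\<^sub>F k in sequentially. Qcost d t (x k n) - Qc k t (x k n) \<le> ereal (0 + \<epsilon>) \<and>
      ereal 0 \<le> Qcost d t (x k n) - Qc k t (x k n) + ereal \<epsilon>"
      using eventually_small_gap[OF t \<open>\<epsilon> > 0\<close>] eventually_ge_at_top[of 1]
    proof eventually_elim
      case (elim k)
      have Q: "Qcost d t (x k n) = ereal (h (x k n))" by (intro h x_in elim t1 t)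
      have "ereal (h (x k n)) \<le> Qc (k - 1) t (x k n) + ereal \<epsilon>"
        using elim(1) unfolding gap_le_def Q .
      also have "\<dots> \<le> Qc k t (x k n) + ereal \<epsilon>"
        by (intro add_right_mono Qc_mono t) simp
      finally have "ereal (h (x k n)) \<le> Qc k t (x k n) + ereal \<epsilon>" .
      moreover have "Qc k t (x k n) \<le> ereal (h (x k n))"
        using Qc_le_Qcost[OF t(1), of k "x k n"] Q by simp
      ultimately show ?case using \<open>\<epsilon> > 0\<close> unfolding Q by (cases "Qc k t (x k n)") auto
    qed
  qed
  then show ?thesis by (simp add: zero_ereal_def)
qed

text \<open>The common source of the limit of the lower bounds and of the optimality of accumulation
  points.\<close>

lemma forward_exact_eventually_le:
  assumes t: "t \<in> {1..msT d}" "node d t m" and \<epsilon>: "\<epsilon> > 0"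
  shows "\<forall>\<^sub>F k in sequentially.
      msf d t (ridx m) (pdec (msx0 d) (x k) m) (x k m) + Qcost d (Suc t) (x k m)
        \<le> lowQ d (Qc (k - 1) (Suc t)) t (pdec (msx0 d) (x k) m) (ridx m) + ereal \<epsilon>"
proof -
  have "\<forall>\<^sub>F k in sequentially. small_gap (Suc t) m (\<epsilon> / 2) k"
    using eventually_small_gap[of "Suc t" m "\<epsilon> / 2"] t \<epsilon> by simp
  moreover have "\<forall>\<^sub>F k in sequentially. lam t k * Dsq t < \<epsilon> / 2"
    using order_tendstoD(2)[OF lam_Dsq_lim[OF t(1)], of "\<epsilon> / 2"] \<epsilon> by simp
  ultimately show ?thesis using eventually_ge_at_top[of 1]
  proof eventually_elim
    case (elim k)
    have "msf d t (ridx m) (pdec (msx0 d) (x k) m) (x k m) + Qcost d (Suc t) (x k m)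
        \<le> lowQ d (Qc (k - 1) (Suc t)) t (pdec (msx0 d) (x k) m) (ridx m)
          + ereal (lam t k * Dsq t + \<epsilon> / 2)"
      using forward_exact_le_lowQ[OF elim(3) t] elim(1) unfolding gap_le_def by blast
    also have "\<dots> \<le> lowQ d (Qc (k - 1) (Suc t)) t (pdec (msx0 d) (x k) m) (ridx m) + ereal \<epsilon>"
      using elim(2) by (intro add_left_mono) simp
    finally show ?case .
  qed
qed

lemma root_node: "1 \<in> {1..msT d}" "node d 1 []" "pdec x0 xs [] = x0" "ridx [] = 0" "0 < nsc d 1"
  using T_ge by (auto simp: node_def pdec_def ridx_def nsc_def)

lemma optimal_value_finite:
  obtains v where "Qfrak d 1 (msx0 d) 0 = ereal v"
proof -
  have "convex_near {msx0 d} (\<lambda>y. Qfrak d 1 y 0)"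
    using Qfrak_convex_near[OF root_node(1,5)] by (simp add: Xst_def)
  then show ?thesis using that unfolding convex_near_def by blast
qed

lemma optimal_value_le:
  assumes "k \<ge> 1"
  shows "Qfrak d 1 (msx0 d) 0 \<le> msf d 1 0 (msx0 d) (x k []) + Qcost d 2 (x k [])"
  using lowQ_le[OF x_Xset[OF assms root_node(1,2)]]
  by (simp add: Qfrak_def root_node numeral_2_eq_2)

text \<open>From above by validity of the cuts. From below, the optimal value is at most the exact
  cost of the forward decision, which is nearly the minimum for the previous and hence for the
  current approximation.\<close>

lemma lower_bound_lim:
  "(\<lambda>k. lowQ d (Qc k 2) 1 (msx0 d) 0) \<longlonglongrightarrow> Qfrak d 1 (msx0 d) 0"
proof -
  obtain v where v: "Qfrak d 1 (msx0 d) 0 = ereal v" by (rule optimal_value_finite)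
  show ?thesis unfolding v
  proof (rule tendsto_ereal_epsI)
    fix \<epsilon> :: real assume \<epsilon>: "\<epsilon> > 0"
    show "\<forall>\<^sub>F k in sequentially. lowQ d (Qc k 2) 1 (msx0 d) 0 \<le> ereal (v + \<epsilon>) \<and>
        ereal v \<le> lowQ d (Qc k 2) 1 (msx0 d) 0 + ereal \<epsilon>"
      using forward_exact_eventually_le[OF root_node(1,2) \<epsilon>] eventually_ge_at_top[of 1]
    proof eventually_elim
      case (elim k)
      have "lowQ d (Qc k 2) 1 (msx0 d) 0 \<le> ereal v"
        using lowQ_Qc_le_Qfrak[OF root_node(1), of k "msx0 d" 0] v by (simp add: numeral_2_eq_2)
      moreover have "ereal v \<le> ereal (v + \<epsilon>)" using \<epsilon> by simp
      moreover have "ereal v \<le> lowQ d (Qc (k - 1) 2) 1 (msx0 d) 0 + ereal \<epsilon>"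
        using order_trans[OF optimal_value_le[OF elim(2)]] elim(1) v
        by (simp add: root_node numeral_2_eq_2)
      moreover have "lowQ d (Qc (k - 1) 2) 1 (msx0 d) 0 \<le> lowQ d (Qc k 2) 1 (msx0 d) 0"
        using T_ge by (intro lowQ_mono Qc_mono) auto
      ultimately show ?case by (meson add_right_mono order_trans)
    qed
  qed
qed

text \<open>The upper estimate needs the vanishing penalty, the lower one the small gap at the root
  and the nonnegativity of the penalty.\<close>

lemma forward_value_lim:
  "(\<lambda>k. msf d 1 0 (msx0 d) (x k []) + Qc (k - 1) 2 (x k [])
      + ereal (lam 1 k * (norm (x k [] - xP k 1))\<^sup>2)) \<longlonglongrightarrow> Qfrak d 1 (msx0 d) 0"
proof -
  obtain v where v: "Qfrak d 1 (msx0 d) 0 = ereal v" by (rule optimal_value_finite)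
  show ?thesis unfolding v
  proof (rule tendsto_ereal_epsI)
    fix \<epsilon> :: real assume \<epsilon>: "\<epsilon> > 0"
    have "\<forall>\<^sub>F k in sequentially. lam 1 k * Dsq 1 < \<epsilon>"
      using order_tendstoD(2)[OF lam_Dsq_lim[OF root_node(1)] \<epsilon>] .
    moreover have "\<forall>\<^sub>F k in sequentially. small_gap 2 [] \<epsilon> k"
      using eventually_small_gap[of 2 "[]" \<epsilon>] root_node(2) T_ge \<epsilon> by simp
    ultimately show "\<forall>\<^sub>F k in sequentially. msf d 1 0 (msx0 d) (x k []) + Qc (k - 1) 2 (x k [])
          + ereal (lam 1 k * (norm (x k [] - xP k 1))\<^sup>2) \<le> ereal (v + \<epsilon>) \<and>
        ereal v \<le> msf d 1 0 (msx0 d) (x k []) + Qc (k - 1) 2 (x k [])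
          + ereal (lam 1 k * (norm (x k [] - xP k 1))\<^sup>2) + ereal \<epsilon>"
      using eventually_ge_at_top[of 1]
    proof eventually_elim
      case (elim k)
      let ?f = "msf d 1 0 (msx0 d) (x k [])"
      have "?f + Qc (k - 1) 2 (x k []) + ereal (lam 1 k * (norm (x k [] - xP k 1))\<^sup>2)
          \<le> lowQ d (Qc (k - 1) 2) 1 (msx0 d) 0 + ereal (lam 1 k * Dsq 1)"
        using forward_le_lowQ[OF elim(3) root_node(1,2)] by (simp add: root_node numeral_2_eq_2)
      also have "\<dots> \<le> ereal v + ereal \<epsilon>"
        using lowQ_Qc_le_Qfrak[OF root_node(1), of "k - 1" "msx0 d" 0] v elim(1)
        by (intro add_mono) (auto simp: numeral_2_eq_2)
      finally have up: "?f + Qc (k - 1) 2 (x k []) + ereal (lam 1 k * (norm (x k [] - xP k 1))\<^sup>2)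
          \<le> ereal (v + \<epsilon>)" by simp
      have "ereal v \<le> ?f + Qcost d 2 (x k [])" using optimal_value_le[OF elim(3)] v by simp
      also have "\<dots> \<le> ?f + (Qc (k - 1) 2 (x k []) + ereal \<epsilon>)"
        using elim(2) unfolding gap_le_def by (rule add_left_mono)
      also have "\<dots> = ?f + Qc (k - 1) 2 (x k []) + ereal \<epsilon>" by (simp add: add.assoc)
      also have "\<dots> \<le> ?f + Qc (k - 1) 2 (x k [])
          + ereal (lam 1 k * (norm (x k [] - xP k 1))\<^sup>2) + ereal \<epsilon>"
        using lam_nonneg[of 1 k] by (intro add_right_mono) (simp add: ereal_le_add_self)
      finally show ?case using up by blast
    qed
  qed
qed

text \<open>The constraint functions are finite and convex on the whole space, hence continuous, so
  the inequalities survive the limit.\<close>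

lemma Xset_closed:
  assumes t: "t \<in> {1..msT d}" "j < nsc d t"
    and lim: "Y \<longlonglongrightarrow> y" "Z \<longlonglongrightarrow> z" and Z: "\<forall>\<^sub>F k in sequentially. Z k \<in> Xset d t (Y k) j"
  shows "z \<in> Xset d t y j"
proof -
  have "\<forall>\<^sub>F k in sequentially. Z k \<in> msX d t"
    using Z by eventually_elim (simp add: Xset_def)
  then have "z \<in> msX d t"
    using Lim_in_closed_set[OF compact_imp_closed[OF X_compact[OF t(1)]] _ _ lim(2)] by simp
  moreover have "msg d t j i y z \<le> 0" if i: "i < msncon d t" for i
  proof -
    have "continuous_on UNIV (\<lambda>(y, x). msg d t j i y x)"
      using convex_on_continuous[OF open_UNIV g_convex[OF t i]] .
    then have "(\<lambda>k. msg d t j i (Y k) (Z k)) \<longlonglongrightarrow> msg d t j i y z"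
      using continuous_on_tendsto_compose[OF _ tendsto_Pair[OF lim], of UNIV "\<lambda>(y, x). msg d t j i y x"]
      by simp
    then show ?thesis
      by (rule tendsto_upperbound) (use Z i in \<open>auto simp: Xset_def elim: eventually_mono\<close>)
  qed
  moreover have "msA d t j *v z + msB d t j *v y = msb d t j"
  proof (rule LIMSEQ_unique)
    show "(\<lambda>k. msA d t j *v Z k + msB d t j *v Y k) \<longlonglongrightarrow> msA d t j *v z + msB d t j *v y"
      using lim by (intro tendsto_add bounded_linear.tendsto[OF matrix_vector_mul_bounded_linear])
    show "(\<lambda>k. msA d t j *v Z k + msB d t j *v Y k) \<longlonglongrightarrow> msb d t j"
      by (rule tendsto_eventually) (use Z in \<open>auto simp: Xset_def elim: eventually_mono\<close>)
  qed
  ultimately show ?thesis by (simp add: Xset_def)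
qed

lemma pdec_in:
  assumes "k \<ge> 1" "t \<in> {1..msT d}" "node d t m"
  shows "pdec (msx0 d) (x k) m \<in> Xst d (t - 1)"
proof (cases "m = []")
  case True
  then show ?thesis using assms by (auto simp: node_def pdec_def Xst_def)
next
  case False
  then have "t - 1 \<in> {1..msT d}" "node d (t - 1) (butlast m)"
    using assms by (auto simp: node_def Suc_le_eq dest: in_set_butlastD)
  then show ?thesis using x_in[OF assms(1)] False by (auto simp: pdec_def Xst_def)
qed

text \<open>The cost is only lower semicontinuous, but \<open>Qfrak\<close> and \<open>Qcost\<close>
  are continuous on the compact sets in question. With these two on the right-hand side, the
  near-optimality of the forward decisions passes to the limit.\<close>

lemma accumulation_point_optimal:
  assumes r: "strict_mono r"
    and lim: "\<And>t n. t \<in> {1..msT d} \<Longrightarrow> node d t n \<Longrightarrow> (\<lambda>k. x (r k) n) \<longlonglongrightarrow> xs n"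
    and t: "t \<in> {1..msT d}" and m: "node d t m"
  shows "is_argmin (Xset d t (pdec (msx0 d) xs m) (ridx m))
    (\<lambda>z. msf d t (ridx m) (pdec (msx0 d) xs m) z + Qcost d (Suc t) z) (xs m)"
proof -
  define Y y j where "Y = (\<lambda>k. pdec (msx0 d) (x (r k)) m)" and "y = pdec (msx0 d) xs m"
    and "j = ridx m"
  have j: "j < nsc d t"
    using m M_ge by (auto simp: j_def node_def ridx_def nsc_def dest: last_in_set)
  have r1: "\<forall>\<^sub>F k in sequentially. r k \<ge> 1"
    using filterlim_subseq[OF r] by (simp add: filterlim_at_top)
  have Y: "Y \<longlonglongrightarrow> y"
  proof (cases "m = []")
    case False
    then have "t - 1 \<in> {1..msT d}" "node d (t - 1) (butlast m)"
      using m t by (auto simp: node_def Suc_le_eq dest: in_set_butlastD)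
    then show ?thesis using lim False by (simp add: Y_def y_def pdec_def)
  qed (simp add: Y_def y_def pdec_def)
  have X: "(\<lambda>k. x (r k) m) \<longlonglongrightarrow> xs m" using lim t m .
  have YX: "\<forall>\<^sub>F k in sequentially. Y k \<in> Xst d (t - 1) \<and> x (r k) m \<in> Xset d t (Y k) j"
    using r1 by eventually_elim (use pdec_in[OF _ t m] x_Xset[OF _ t m] in \<open>simp add: Y_def j_def\<close>)
  have t1: "t - 1 \<le> msT d" using t by auto
  have "\<forall>\<^sub>F k in sequentially. Y k \<in> Xst d (t - 1)"
    using YX by eventually_elim simp
  then have y_in: "y \<in> Xst d (t - 1)"
    using Lim_in_closed_set[OF compact_imp_closed[OF Xst_compact[OF t1]] _ _ Y] by simp
  have feas: "xs m \<in> Xset d t y j"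
    by (rule Xset_closed[OF t j Y X]) (use YX in \<open>eventually_elim, simp\<close>)
  then have xs_in: "xs m \<in> msX d t" using Xset_subset by blast
  have t2: "Suc t \<in> {2..Suc (msT d)}" "Suc t - 1 = t" using t by auto
  obtain h where h: "continuous_on (msX d t) h" "\<And>z. z \<in> msX d t \<Longrightarrow> Qcost d (Suc t) z = ereal (h z)"
    by (rule Qcost_finite[OF t2(1), unfolded t2(2)], rule that)
  obtain g where g: "continuous_on (Xst d (t - 1)) g"
      "\<And>z. z \<in> Xst d (t - 1) \<Longrightarrow> Qfrak d t z j = ereal (g z)"
    by (rule convex_nearE[OF Qfrak_convex_near[OF t j] Xst_compact[OF t1]], rule that)
  have "msf d t j y (xs m) \<le> ereal (g y - h (xs m)) + ereal \<epsilon>" if \<epsilon>: "\<epsilon> > 0" for \<epsilon>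
  proof -
    have "(\<lambda>(y, x). msf d t j y x) (y, xs m) \<le> ereal (g y - h (xs m) + \<epsilon>)"
    proof (rule lsc_fun_le_lim[OF f_lsc[OF t j] tendsto_Pair[OF Y X]])
      have "(\<lambda>k. g (Y k)) \<longlonglongrightarrow> g y"
        by (rule continuous_on_tendsto_compose[OF g(1) Y y_in]) (use YX in \<open>eventually_elim, simp\<close>)
      moreover have "(\<lambda>k. h (x (r k) m)) \<longlonglongrightarrow> h (xs m)"
        by (rule continuous_on_tendsto_compose[OF h(1) X xs_in])
          (use YX in \<open>eventually_elim, use Xset_subset in blast\<close>)
      ultimately show "(\<lambda>k. ereal (g (Y k) - h (x (r k) m) + \<epsilon>)) \<longlonglongrightarrow> ereal (g y - h (xs m) + \<epsilon>)"
        by (intro tendsto_intros)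
      have "\<forall>\<^sub>F k in sequentially.
          msf d t (ridx m) (pdec (msx0 d) (x (r k)) m) (x (r k) m) + Qcost d (Suc t) (x (r k) m)
          \<le> lowQ d (Qc (r k - 1) (Suc t)) t (pdec (msx0 d) (x (r k)) m) (ridx m) + ereal \<epsilon>"
        using eventually_compose_filterlim[OF forward_exact_eventually_le[OF t m \<epsilon>] filterlim_subseq[OF r]] .
      then show "\<forall>\<^sub>F k in sequentially. (\<lambda>(y, x). msf d t j y x) (Y k, x (r k) m)
          \<le> ereal (g (Y k) - h (x (r k) m) + \<epsilon>)"
        using YX
      proof eventually_elim
        case (elim k)
        have "x (r k) m \<in> msX d t" using elim(2) Xset_subset by blast
        then have "msf d t j (Y k) (x (r k) m) + ereal (h (x (r k) m))
            \<le> lowQ d (Qc (r k - 1) (Suc t)) t (Y k) j + ereal \<epsilon>"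
          using elim(1) h(2) by (simp add: Y_def j_def)
        also have "\<dots> \<le> ereal (g (Y k)) + ereal \<epsilon>"
          using lowQ_Qc_le_Qfrak[OF t, of "r k - 1" "Y k" j] g(2) elim(2) by (intro add_right_mono) simp
        finally show ?case by (cases "msf d t j (Y k) (x (r k) m)") auto
      qed
    qed
    then show ?thesis by simp
  qed
  then have "msf d t j y (xs m) \<le> ereal (g y - h (xs m))"
    by (rule ereal_le_epsilon2)
  then have "msf d t j y (xs m) + Qcost d (Suc t) (xs m) \<le> Qfrak d t y j"
    unfolding h(2)[OF xs_in] g(2)[OF y_in] by (cases "msf d t j y (xs m)") auto
  moreover have "Qfrak d t y j \<le> msf d t j y z + Qcost d (Suc t) z" if "z \<in> Xset d t y j" for z
    unfolding Qfrak_def using that by (rule lowQ_le)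
  ultimately show ?thesis
    using feas unfolding is_argmin_def y_def j_def by (meson order_trans)
qed

end

section \<open>Independence of the samples and recurrence of visits\<close>

text \<open>A substitute for measurability with respect to the samples in \<open>I\<close>, stated
  pointwise on the whole type; for finite \<open>I\<close> of the form \<open>prev T k t\<close> it
  yields honest events.\<close>

definition determined_by :: "('w \<Rightarrow> nat \<Rightarrow> nat \<Rightarrow> nat) \<Rightarrow> (nat \<times> nat) set \<Rightarrow> ('w \<Rightarrow> bool) \<Rightarrow> bool" where
  "determined_by s I \<Phi> \<longleftrightarrow>
     (\<forall>\<omega> \<omega>'. (\<forall>(i, u)\<in>I. s \<omega> i u = s \<omega>' i u) \<longrightarrow> \<Phi> \<omega> = \<Phi> \<omega>')"

lemma determined_byI:
  assumes "\<And>\<omega> \<omega>'. (\<And>i u. (i, u) \<in> I \<Longrightarrow> s \<omega> i u = s \<omega>' i u) \<Longrightarrow> \<Phi> \<omega> = \<Phi> \<omega>'"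
  shows "determined_by s I \<Phi>"
  unfolding determined_by_def using assms by blast

lemma determined_byD:
  assumes "determined_by s I \<Phi>" "\<And>i u. (i, u) \<in> I \<Longrightarrow> s \<omega> i u = s \<omega>' i u"
  shows "\<Phi> \<omega> = \<Phi> \<omega>'"
  using assms unfolding determined_by_def by blast

lemma determined_by_mono:
  assumes "determined_by s I \<Phi>" "I \<subseteq> J"
  shows "determined_by s J \<Phi>"
  using assms unfolding determined_by_def by blast

lemma determined_by_conj:
  assumes "determined_by s I \<Phi>" "determined_by s I \<Psi>"
  shows "determined_by s I (\<lambda>\<omega>. \<Phi> \<omega> \<and> \<Psi> \<omega>)"
  using assms unfolding determined_by_def by blast

lemma finite_prev: "finite (prev T k t)"
proof (rule finite_subset)
  show "prev T k t \<subseteq> {..k} \<times> {..max T t}" by (auto simp: prev_def)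
qed simp

locale interstage_sampling = prob_space P for P :: "'w measure" +
  fixes s :: "'w \<Rightarrow> nat \<Rightarrow> nat \<Rightarrow> nat" and T M :: nat and p :: "nat \<Rightarrow> nat \<Rightarrow> real"
  assumes p_pos: "\<And>t j. t \<in> {2..T} \<Longrightarrow> j < M \<Longrightarrow> p t j > 0"
    and law: "\<And>k t j. k \<ge> 1 \<Longrightarrow> t \<in> {2..T} \<Longrightarrow> j < M \<Longrightarrow>
        prob {\<omega> \<in> space P. s \<omega> k t = j} = p t j"
    and indep: "\<And>k t. k \<ge> 1 \<Longrightarrow> t \<in> {2..T} \<Longrightarrow>
        indep_var
          (Pi\<^sub>M {(k, t)} (\<lambda>_. count_space UNIV))
          (\<lambda>\<omega>. restrict (\<lambda>(i, u). s \<omega> i u) {(k, t)})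
          (Pi\<^sub>M (prev T k t) (\<lambda>_. count_space UNIV))
          (\<lambda>\<omega>. restrict (\<lambda>(i, u). s \<omega> i u) (prev T k t))"
begin

text \<open>The samples in \<open>prev T k t\<close> form a finite vector of naturals, for which
  every set of values is measurable; hence \<Phi> defines an event that is independent of the next
  sample.\<close>

lemma next_sample_indep:
  assumes k: "k \<ge> 1" "t \<in> {2..T}" "j < M" and det: "determined_by s (prev T k t) \<Phi>"
  shows "{\<omega> \<in> space P. \<Phi> \<omega>} \<in> events"
    and "{\<omega> \<in> space P. \<Phi> \<omega> \<and> s \<omega> k t = j} \<in> events"
    and "prob {\<omega> \<in> space P. \<Phi> \<omega> \<and> s \<omega> k t = j} = prob {\<omega> \<in> space P. \<Phi> \<omega>} * p t j"
proof -
  define N where "N I = Pi\<^sub>M I (\<lambda>_::nat \<times> nat. count_space (UNIV :: nat set))" for I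
  define R where "R I \<omega> = restrict (\<lambda>(i, u). s \<omega> i u) I" for I \<omega>
  have N: "sets (N I) = Pow (PiE I (\<lambda>_. UNIV))" if "finite I" for I
    unfolding N_def using that by (subst count_space_PiM_finite) auto
  let ?C = "R (prev T k t) ` {\<omega>. \<Phi> \<omega>}" and ?A = "{g \<in> PiE {(k, t)} (\<lambda>_. UNIV). g (k, t) = j}"
  have CA: "?C \<in> sets (N (prev T k t))" "?A \<in> sets (N {(k, t)})"
    by (auto simp: N[OF finite_prev] N R_def)
  \<comment> \<open>\<Phi> is constant on the fibres of the sample vector, so the preimage of the
    image adds no further points.\<close>
  have C: "R (prev T k t) \<omega> \<in> ?C \<longleftrightarrow> \<Phi> \<omega>" for \<omega>
  proof
    assume "R (prev T k t) \<omega> \<in> ?C"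
    then obtain \<omega>' where \<omega>': "\<Phi> \<omega>'" "R (prev T k t) \<omega> = R (prev T k t) \<omega>'" by auto
    have "s \<omega> i u = s \<omega>' i u" if "(i, u) \<in> prev T k t" for i u
      using fun_cong[OF \<omega>'(2), of "(i, u)"] that by (simp add: R_def)
    then show "\<Phi> \<omega>" using determined_byD[OF det] \<omega>'(1) by blast
  qed auto
  have A: "R {(k, t)} \<omega> \<in> ?A \<longleftrightarrow> s \<omega> k t = j" for \<omega>
    by (simp add: R_def)
  have ind: "indep_var (N {(k, t)}) (R {(k, t)}) (N (prev T k t)) (R (prev T k t))"
    using indep[OF k(1,2)] unfolding N_def R_def .
  have eqs: "R (prev T k t) -` ?C \<inter> space P = {\<omega> \<in> space P. \<Phi> \<omega>}"
    "R {(k, t)} -` ?A \<inter> space P = {\<omega> \<in> space P. s \<omega> k t = j}"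
    "(\<lambda>\<omega>. (R {(k, t)} \<omega>, R (prev T k t) \<omega>)) -` (?A \<times> ?C) \<inter> space P
      = {\<omega> \<in> space P. \<Phi> \<omega> \<and> s \<omega> k t = j}"
    using A C by blast+
  show \<Phi>_ev: "{\<omega> \<in> space P. \<Phi> \<omega>} \<in> events"
    using measurable_sets[OF indep_var_rv2[OF ind] CA(1)] unfolding eqs .
  have "{\<omega> \<in> space P. s \<omega> k t = j} \<in> events"
    using measurable_sets[OF indep_var_rv1[OF ind] CA(2)] unfolding eqs .
  from sets.Int[OF \<Phi>_ev this] show "{\<omega> \<in> space P. \<Phi> \<omega> \<and> s \<omega> k t = j} \<in> events"
    by (rule back_subst[of "\<lambda>S. S \<in> events"]) blast
  show "prob {\<omega> \<in> space P. \<Phi> \<omega> \<and> s \<omega> k t = j} = prob {\<omega> \<in> space P. \<Phi> \<omega>} * p t j"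
    using indep_varD[OF ind CA(2,1)] unfolding eqs law[OF k] by simp
qed

text \<open>The list \<open>n\<close> is a node of stage \<open>length n + 1\<close>, so the entry
  appended to it is the sample of stage \<open>length n + 2\<close>.\<close>

lemma sample_node_snoc:
  "sample_node f k (Suc (length (n @ [j]))) = n @ [j] \<longleftrightarrow>
    sample_node f k (Suc (length n)) = n \<and> f k (length n + 2) = j"
  by (simp add: sample_node_def)

lemma sample_node_determined:
  "determined_by s {(i, u). i = k \<and> 2 \<le> u \<and> u < t + 1} (\<lambda>\<omega>. sample_node (s \<omega>) k t = n)"
proof (rule determined_byI)
  fix \<omega> \<omega>' assume "\<And>i u. (i, u) \<in> {(i, u). i = k \<and> 2 \<le> u \<and> u < t + 1} \<Longrightarrow> s \<omega> i u = s \<omega>' i u"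
  then have "sample_node (s \<omega>) k t = sample_node (s \<omega>') k t"
    unfolding sample_node_def by (intro map_cong) auto
  then show "(sample_node (s \<omega>) k t = n) = (sample_node (s \<omega>') k t = n)" by simp
qed

text \<open>Each sample of iteration \<open>k\<close> is independent of the past and of the earlier
  stages of the same iteration, so the probabilities along the path multiply.\<close>

lemma node_indep:
  assumes T: "T \<ge> 2" "M \<ge> 1" and k: "k \<ge> 1" and n: "set n \<subseteq> {..<M}" "length n + 1 \<le> T"
    and det: "determined_by s (prev T k 2) \<Phi>"
  shows "{\<omega> \<in> space P. \<Phi> \<omega> \<and> sample_node (s \<omega>) k (Suc (length n)) = n} \<in> events \<and>
    prob {\<omega> \<in> space P. \<Phi> \<omega> \<and> sample_node (s \<omega>) k (Suc (length n)) = n}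
      = prob {\<omega> \<in> space P. \<Phi> \<omega>} * (\<Prod>i<length n. p (i + 2) (n ! i))"
  using n
proof (induction n rule: rev_induct)
  case Nil
  show ?case using next_sample_indep(1)[OF k _ _ det, of 0] T by (simp add: sample_node_def)
next
  case (snoc j n)
  let ?t = "length n + 2" and ?\<Psi> = "\<lambda>\<omega>. \<Phi> \<omega> \<and> sample_node (s \<omega>) k (Suc (length n)) = n"
  have "determined_by s (prev T k ?t) ?\<Psi>"
    by (intro determined_by_conj determined_by_mono[OF det] determined_by_mono[OF sample_node_determined])
      (auto simp: prev_def)
  moreover have tj: "?t \<in> {2..T}" "j < M" using snoc.prems by auto
  ultimately have \<Psi>: "{\<omega> \<in> space P. ?\<Psi> \<omega> \<and> s \<omega> k ?t = j} \<in> events"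
    "prob {\<omega> \<in> space P. ?\<Psi> \<omega> \<and> s \<omega> k ?t = j} = prob {\<omega> \<in> space P. ?\<Psi> \<omega>} * p ?t j"
    using next_sample_indep[OF k] by blast+
  have "prob {\<omega> \<in> space P. ?\<Psi> \<omega>} = prob {\<omega> \<in> space P. \<Phi> \<omega>} * (\<Prod>i<length n. p (i + 2) (n ! i))"
    using snoc by simp
  moreover have "(\<Prod>i<length n. p (i + 2) ((n @ [j]) ! i)) = (\<Prod>i<length n. p (i + 2) (n ! i))"
    by (intro prod.cong) (auto simp: nth_append)
  then have "(\<Prod>i<length (n @ [j]). p (i + 2) ((n @ [j]) ! i))
      = (\<Prod>i<length n. p (i + 2) (n ! i)) * p ?t j"
    by simp
  ultimately show ?case
    using \<Psi> unfolding sample_node_snoc conj_assoc by (simp only: mult.assoc simp_thms)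
qed

text \<open>A conditional Borel--Cantelli argument. As long as no hit (\<open>E\<close> together with the visit of \<open>n\<close>)
  occurred since \<open>N\<close>, each occurrence of \<open>E\<close> lowers the probability of this by a fixed fraction of
  its own probability, so the probabilities of these occurrences are summable.\<close>
lemma AE_infinitely_often_sampled:
  assumes T: "T \<ge> 2" "M \<ge> 1" and n: "set n \<subseteq> {..<M}" "length n + 1 \<le> T"
    and det: "\<And>k. k \<ge> 1 \<Longrightarrow> determined_by s (prev T k 2) (E k)"
  shows "AE \<omega> in P. infinite {k. E k \<omega>} \<longrightarrow>
    infinite {k. sample_node (s \<omega>) k (Suc (length n)) = n \<and> E k \<omega>}"
proof -
  \<comment> \<open>The probability that an iteration visits \<open>n\<close>, the same for every
    iteration.\<close>
  define q where "q = (\<Prod>i<length n. p (i + 2) (n ! i))"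
  have "q > 0" unfolding q_def
  proof (rule prod_pos)
    fix i assume "i \<in> {..<length n}"
    then have "i < length n" "n ! i \<in> {..<M}" using n(1) nth_mem by blast+
    then show "0 < p (i + 2) (n ! i)" using n(2) by (intro p_pos) auto
  qed
  define S where "S k \<omega> \<longleftrightarrow> sample_node (s \<omega>) k (Suc (length n)) = n" for k \<omega>
  \<comment> \<open>No hit from \<open>N\<close> up to, but excluding, \<open>k\<close>: the strict
    bound keeps this determined by the iterations before \<open>k\<close>.\<close>
  define B where "B N k \<omega> \<longleftrightarrow> (\<forall>i. N \<le> i \<and> i < k \<longrightarrow> \<not> (E i \<omega> \<and> S i \<omega>))" for N k \<omega>
  have det_B: "determined_by s (prev T k 2) (B N k)" if "N \<ge> 1" for N k
  proof (rule determined_byI)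
    fix \<omega> \<omega>' assume eq: "\<And>i u. (i, u) \<in> prev T k 2 \<Longrightarrow> s \<omega> i u = s \<omega>' i u"
    have "E i \<omega> = E i \<omega>'" "S i \<omega> = S i \<omega>'" if "N \<le> i" "i < k" for i
    proof -
      have "prev T i 2 \<subseteq> prev T k 2" using that by (auto simp: prev_def)
      then show "E i \<omega> = E i \<omega>'"
        using that \<open>N \<ge> 1\<close> eq by (intro determined_byD[OF det]) auto
      show "S i \<omega> = S i \<omega>'" unfolding S_def
        using that \<open>N \<ge> 1\<close> n eq by (intro determined_byD[OF sample_node_determined]) (auto simp: prev_def)
    qed
    then show "B N k \<omega> = B N k \<omega>'" unfolding B_def by blast
  qed
  have finite_E: "AE \<omega> in P. \<forall>\<^sub>F i in sequentially. \<omega> \<in> space P - {\<omega> \<in> space P. B N (N + i) \<omega> \<and> E (N + i) \<omega>}"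
    if N: "N \<ge> 1" for N
  proof (rule borel_cantelli_AE1)
    have BE: "{\<omega> \<in> space P. B N (N + i) \<omega> \<and> E (N + i) \<omega>} \<in> events"
      "{\<omega> \<in> space P. B N (N + i) \<omega>} \<in> events"
      "{\<omega> \<in> space P. (B N (N + i) \<omega> \<and> E (N + i) \<omega>) \<and> S (N + i) \<omega>} \<in> events"
      "prob {\<omega> \<in> space P. (B N (N + i) \<omega> \<and> E (N + i) \<omega>) \<and> S (N + i) \<omega>}
        = prob {\<omega> \<in> space P. B N (N + i) \<omega> \<and> E (N + i) \<omega>} * q" for i
    proof -
      have k: "N + i \<ge> 1" using N by simp
      have d: "determined_by s (prev T (N + i) 2) (\<lambda>\<omega>. B N (N + i) \<omega> \<and> E (N + i) \<omega>)"
        by (intro determined_by_conj det_B det N k)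
      have TM: "2 \<in> {2..T}" "0 < M" using T by auto
      show "{\<omega> \<in> space P. B N (N + i) \<omega> \<and> E (N + i) \<omega>} \<in> events"
        by (rule next_sample_indep(1)[OF k TM d])
      show "{\<omega> \<in> space P. B N (N + i) \<omega>} \<in> events"
        by (rule next_sample_indep(1)[OF k TM det_B[OF N]])
      show "{\<omega> \<in> space P. (B N (N + i) \<omega> \<and> E (N + i) \<omega>) \<and> S (N + i) \<omega>} \<in> events"
        "prob {\<omega> \<in> space P. (B N (N + i) \<omega> \<and> E (N + i) \<omega>) \<and> S (N + i) \<omega>}
          = prob {\<omega> \<in> space P. B N (N + i) \<omega> \<and> E (N + i) \<omega>} * q"
        using node_indep[OF T k n d] unfolding S_def q_def by blast+
    qed
    then show "\<And>i. {\<omega> \<in> space P. B N (N + i) \<omega> \<and> E (N + i) \<omega>} \<in> events" by blast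
    show "\<And>i. emeasure P {\<omega> \<in> space P. B N (N + i) \<omega> \<and> E (N + i) \<omega>} < \<infinity>"
      by (simp add: less_top[symmetric])
    let ?a = "\<lambda>i. prob {\<omega> \<in> space P. B N (N + i) \<omega> \<and> E (N + i) \<omega>}"
      and ?b = "\<lambda>i. prob {\<omega> \<in> space P. B N (N + i) \<omega>}"
    \<comment> \<open>Survival is lost exactly when a hit occurs, and a hit has the conditional
      probability \<open>q\<close>; the resulting telescoping sum is bounded by one.\<close>
    have step: "?a i * q = ?b i - ?b (Suc i)" for i
    proof -
      have "{\<omega> \<in> space P. B N (N + Suc i) \<omega>} = {\<omega> \<in> space P. B N (N + i) \<omega>}
          - {\<omega> \<in> space P. (B N (N + i) \<omega> \<and> E (N + i) \<omega>) \<and> S (N + i) \<omega>}"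
        by (auto simp: B_def less_Suc_eq)
      then have "?b (Suc i) = ?b i
          - prob {\<omega> \<in> space P. (B N (N + i) \<omega> \<and> E (N + i) \<omega>) \<and> S (N + i) \<omega>}"
        using finite_measure_Diff[OF BE(2)[of i] BE(3)[of i]] by auto
      then show ?thesis using BE(4)[of i] by simp
    qed
    have "(\<Sum>i<m. ?a i) \<le> 1 / q" for m
    proof -
      have "(\<Sum>i<m. ?a i) * q = ?b 0 - ?b m"
        unfolding sum_distrib_right step by (rule sum_lessThan_telescope')
      also have "\<dots> \<le> 1" using prob_le_1 measure_nonneg by (smt (verit))
      finally show ?thesis using \<open>q > 0\<close> by (simp add: pos_le_divide_eq)
    qed
    then show "summable ?a"
      by (intro summableI_nonneg_bounded[where x = "1 / q"]) auto
  qed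
  \<comment> \<open>The shift to \<open>Suc N\<close> respects the start of the iterations at
    one.\<close>
  have "AE \<omega> in P. \<forall>N. \<forall>\<^sub>F i in sequentially.
      \<omega> \<in> space P - {\<omega> \<in> space P. B (Suc N) (Suc N + i) \<omega> \<and> E (Suc N + i) \<omega>}"
    unfolding AE_all_countable by (intro allI finite_E) simp
  then show ?thesis
  proof (rule AE_mp[OF _ AE_I2], intro impI notI)
    fix \<omega> assume \<omega>: "\<omega> \<in> space P"
      and ev: "\<forall>N. \<forall>\<^sub>F i in sequentially.
        \<omega> \<in> space P - {\<omega> \<in> space P. B (Suc N) (Suc N + i) \<omega> \<and> E (Suc N + i) \<omega>}"
      and inf: "infinite {k. E k \<omega>}"
      and fin: "finite {k. sample_node (s \<omega>) k (Suc (length n)) = n \<and> E k \<omega>}"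
    obtain N where N: "\<And>k. S k \<omega> \<Longrightarrow> E k \<omega> \<Longrightarrow> k \<le> N"
      using fin unfolding finite_nat_set_iff_bounded_le S_def by auto
    \<comment> \<open>\<open>N\<close> bounds the finitely many hits, so survival from
      \<open>Suc N\<close> on never fails and \<open>E\<close> can occur only finitely
      often.\<close>
    then have "B (Suc N) k \<omega>" for k unfolding B_def by force
    then have "\<forall>\<^sub>F i in sequentially. \<not> E (i + Suc N) \<omega>"
      using spec[OF ev, of N] \<omega> by (auto simp: add.commute elim: eventually_mono)
    then have "\<forall>\<^sub>F k in sequentially. \<not> E k \<omega>"
      using eventually_sequentially_seg[of "\<lambda>k. \<not> E k \<omega>" "Suc N"] by simp
    then show False using inf by (simp add: eventually_cofinite flip: cofinite_eq_sequentially)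
  qed
qed

end

section \<open>Nonanticipativity of the gaps and conclusion\<close>

text \<open>Compares the approximations of two sample paths, to show that those of iteration
  \<open>k - 1\<close> are determined by the samples before iteration \<open>k\<close>.\<close>

lemma Qc_determined:
  assumes paths: "sreda_path d lam Q0 s xP x pg Qc" "sreda_path d lam Q0 s' xP' x' pg' Qc'"
    and x: "\<And>k t m. 1 \<le> k \<Longrightarrow> k \<le> K \<Longrightarrow> t \<in> {1..msT d} \<Longrightarrow> node d t m \<Longrightarrow> x k m = x' k m"
    and pg: "\<And>k t j. 1 \<le> k \<Longrightarrow> k \<le> K \<Longrightarrow> t \<in> {2..msT d} \<Longrightarrow> j < msM d \<Longrightarrow> pg k t j = pg' k t j"
    and s: "\<And>k t. 1 \<le> k \<Longrightarrow> k \<le> K \<Longrightarrow> t \<in> {2..msT d} \<Longrightarrow> s k t = s' k t"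
    and t: "t \<in> {2..Suc (msT d)}"
  shows "Qc K t = Qc' K t"
proof -
  interpret A: sreda_path d lam Q0 s xP x pg Qc by fact
  interpret B: sreda_path d lam Q0 s' xP' x' pg' Qc' by fact
  have "Qc k t = Qc' k t" if "k \<le> K" "t \<in> {2..Suc (msT d)}" for k t
    using that
  proof (induction k arbitrary: t)
    case 0
    then show ?case
      by (cases "t = Suc (msT d)") (simp_all add: A.Qc_last B.Qc_last A.Qc_0 B.Qc_0)
  next
    case (Suc k)
    have "t \<le> Suc (msT d)" using Suc.prems by simp
    then show ?case using Suc.prems(2)
    proof (induction t rule: inc_induct)
      case base
      show ?case by (simp add: A.Qc_last B.Qc_last)
    next
      case (step t)
      have t: "t \<in> {2..msT d}" "t - 1 \<in> {1..msT d}" using step by auto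
      have k: "1 \<le> Suc k" "Suc k \<le> K" using Suc.prems by auto
      have sn: "sample_node s (Suc k) (t - 1) = sample_node s' (Suc k) (t - 1)"
        unfolding sample_node_def using s[OF k] t by (intro map_cong) auto
      have tr: "A.trial (Suc k) t = B.trial (Suc k) t"
        unfolding sn using B.sample_node_node[OF k(1) t(2)] by (intro x[OF k t(2)])
      have Q: "Qc (Suc k) (Suc t) = Qc' (Suc k) (Suc t)" using step.IH t by simp
      have "A.theta (Suc k) t = B.theta (Suc k) t"
        unfolding A.theta_def B.theta_def Q tr ..
      moreover have "A.beta (Suc k) t = B.beta (Suc k) t"
        unfolding A.beta_def B.beta_def using pg[OF k t(1)] by simp
      moreover have "Qc k t = Qc' k t" using Suc.IH Suc.prems t by simp
      ultimately show ?case
        by (intro ext) (simp only: A.Qc_cut[OF k(1) t(1)] B.Qc_cut[OF k(1) t(1)] tr diff_Suc_1)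
    qed
  qed
  then show ?thesis using t by simp
qed

theorem mainTheorem5:
  fixes d :: "('n::finite, 'm::finite) msp"
    and P :: "'w measure"
    and s :: "'w \<Rightarrow> nat \<Rightarrow> nat \<Rightarrow> nat"
    and lam :: "nat \<Rightarrow> nat \<Rightarrow> real"
    and Q0 :: "nat \<Rightarrow> real^'n \<Rightarrow> ereal"
    and xP :: "'w \<Rightarrow> nat \<Rightarrow> nat \<Rightarrow> real^'n"
    and x :: "'w \<Rightarrow> nat \<Rightarrow> nat list \<Rightarrow> real^'n"
    and pg :: "'w \<Rightarrow> nat \<Rightarrow> nat \<Rightarrow> nat \<Rightarrow> real^'n"
    and Qc :: "'w \<Rightarrow> nat \<Rightarrow> nat \<Rightarrow> real^'n \<Rightarrow> ereal"
  assumes H1: "H1 d"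
    and H2: "H2 d"
    and P: "prob_space P"
    and s_range: "\<And>\<omega> k t. k \<ge> 1 \<Longrightarrow> t \<in> {2..msT d} \<Longrightarrow> s \<omega> k t < msM d"
    and H3_law: "\<And>k t j. k \<ge> 1 \<Longrightarrow> t \<in> {2..msT d} \<Longrightarrow> j < msM d \<Longrightarrow>
        measure P {\<omega> \<in> space P. s \<omega> k t = j} = msp d t j"
    and H3_indep: "\<And>k t. k \<ge> 1 \<Longrightarrow> t \<in> {2..msT d} \<Longrightarrow>
        prob_space.indep_var P
          (Pi\<^sub>M {(k, t)} (\<lambda>_. count_space UNIV))
          (\<lambda>\<omega>. restrict (\<lambda>(i, u). s \<omega> i u) {(k, t)})
          (Pi\<^sub>M (prev (msT d) k t) (\<lambda>_. count_space UNIV))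
          (\<lambda>\<omega>. restrict (\<lambda>(i, u). s \<omega> i u) (prev (msT d) k t))"
    and lam_nonneg: "\<And>t k. lam t k \<ge> 0"
    and lam_first: "\<And>t. lam t 1 = 0"
    and lam_T: "\<And>k. lam (msT d) k = 0"
    and lam_lim: "\<And>t. t \<in> {1..msT d - 1} \<Longrightarrow> (lam t \<longlonglongrightarrow> 0)"
    and Q0_le: "\<And>t y. t \<in> {2..msT d} \<Longrightarrow> Q0 t y \<le> Qcost d t y"
    and run: "\<And>\<omega>. sreda_run d lam Q0 (s \<omega>) (xP \<omega>) (x \<omega>) (pg \<omega>) (Qc \<omega>)"
    and nonant_x: "\<And>\<omega> \<omega>' k. (\<And>i u. 1 \<le> i \<Longrightarrow> i < k \<Longrightarrow> u \<in> {2..msT d} \<Longrightarrow> s \<omega> i u = s \<omega>' i u) \<Longrightarrow>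
        (\<forall>t \<in> {1..msT d}. xP \<omega> k t = xP \<omega>' k t \<and>
           (\<forall>m. node d t m \<longrightarrow> x \<omega> k m = x \<omega>' k m))"
    and nonant_pi: "\<And>\<omega> \<omega>' k. (\<And>i u. 1 \<le> i \<Longrightarrow> i \<le> k \<Longrightarrow> u \<in> {2..msT d} \<Longrightarrow> s \<omega> i u = s \<omega>' i u) \<Longrightarrow>
        (\<forall>t \<in> {2..msT d}. \<forall>j < msM d. pg \<omega> k t j = pg \<omega>' k t j)"
  shows "AE \<omega> in P.
     (\<forall>t \<in> {2..Suc (msT d)}. \<forall>n. node d (t - 1) n \<longrightarrow>
        ((\<lambda>k. Qcost d t (x \<omega> k n) - Qc \<omega> k t (x \<omega> k n)) \<longlonglongrightarrow> 0))
   \<and> ((\<lambda>k. msf d 1 0 (msx0 d) (x \<omega> k []) + Qc \<omega> (k - 1) 2 (x \<omega> k [])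
           + ereal (lam 1 k * (norm (x \<omega> k [] - xP \<omega> k 1))\<^sup>2))
        \<longlonglongrightarrow> Qfrak d 1 (msx0 d) 0)
   \<and> ((\<lambda>k. lowQ d (Qc \<omega> k 2) 1 (msx0 d) 0) \<longlonglongrightarrow> Qfrak d 1 (msx0 d) 0)
   \<and> (\<forall>xs r. strict_mono r \<and>
        (\<forall>t \<in> {1..msT d}. \<forall>n. node d t n \<longrightarrow> ((\<lambda>k. x \<omega> (r k) n) \<longlonglongrightarrow> xs n)) \<longrightarrow>
        (\<forall>t \<in> {1..msT d}. \<forall>m. node d t m \<longrightarrow>
           is_argmin (Xset d t (pdec (msx0 d) xs m) (ridx m))
             (\<lambda>z. msf d t (ridx m) (pdec (msx0 d) xs m) z + Qcost d (Suc t) z) (xs m)))"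
proof -
  interpret prob_space P by (rule P)
  interpret regular_msp d using H1 H2 by unfold_locales
  interpret interstage_sampling P s "msT d" "msM d" "msp d"
    using prob_pos H3_law H3_indep by unfold_locales
  have lam_lim': "lam t \<longlonglongrightarrow> 0" if "t \<in> {1..msT d}" for t
  proof (cases "t = msT d")
    case True
    then have "lam t = (\<lambda>_. 0)" using lam_T by blast
    then show ?thesis by simp
  next
    case False
    then show ?thesis using that by (intro lam_lim) auto
  qed
  have path: "sreda_path d lam Q0 (s \<omega>) (xP \<omega>) (x \<omega>) (pg \<omega>) (Qc \<omega>)" for \<omega>
    using s_range lam_nonneg lam_lim' Q0_le run by unfold_locales
  let ?gap = "\<lambda>\<omega>. gap_le d (x \<omega>) (Qc \<omega>)"
  \<comment> \<open>\<open>prev (msT d) k 2\<close> holds exactly the samples of the iterations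
    before \<open>k\<close>: they fix the decisions up to \<open>k\<close> and the subgradients up
    to \<open>k - 1\<close>.\<close>
  have det: "determined_by s (prev (msT d) k 2) (\<lambda>\<omega>. \<not> ?gap \<omega> t n \<epsilon> k)"
    if t: "t \<in> {2..msT d}" "node d (t - 1) n" and k: "k \<ge> 1" for t n \<epsilon> k
  proof (rule determined_byI)
    fix \<omega> \<omega>' assume eq: "\<And>i u. (i, u) \<in> prev (msT d) k 2 \<Longrightarrow> s \<omega> i u = s \<omega>' i u"
    then have s: "s \<omega> i u = s \<omega>' i u" if "1 \<le> i" "i < k" "u \<in> {2..msT d}" for i u
      using that by (auto simp: prev_def)
    have x: "x \<omega> k' m = x \<omega>' k' m" if "1 \<le> k'" "k' \<le> k" "t \<in> {1..msT d}" "node d t m" for k' t m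
      using nonant_x[of k' \<omega> \<omega>'] s that by auto
    have pg: "pg \<omega> k' t j = pg \<omega>' k' t j"
      if "1 \<le> k'" "k' \<le> k - 1" "t \<in> {2..msT d}" "j < msM d" for k' t j
      using nonant_pi[of k' \<omega> \<omega>'] s that by auto
    have "Qc \<omega> (k - 1) t = Qc \<omega>' (k - 1) t"
      using t by (intro Qc_determined[OF path path x pg s]) auto
    moreover have "t - 1 \<in> {1..msT d}" using t by auto
    ultimately show "(\<not> ?gap \<omega> t n \<epsilon> k) = (\<not> ?gap \<omega>' t n \<epsilon> k)"
      using x[of k "t - 1" n] t(2) k by (simp add: gap_le_def)
  qed
  have sampled: "AE \<omega> in P. t \<in> {2..msT d} \<and> node d (t - 1) n \<longrightarrow>
      infinite {k. \<not> ?gap \<omega> t n (1 / Suc i) k} \<longrightarrow>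
      infinite {k. sample_node (s \<omega>) k (t - 1) = n \<and> \<not> ?gap \<omega> t n (1 / Suc i) k}" for t n i
  proof (cases "t \<in> {2..msT d} \<and> node d (t - 1) n")
    case True
    then have "t - 1 = Suc (length n)" "set n \<subseteq> {..<msM d}" by (auto simp: node_def)
    then show ?thesis
      using AE_infinitely_often_sampled[of n "\<lambda>k \<omega>. \<not> ?gap \<omega> t n (1 / Suc i) k"] det True M_ge by auto
  next
    case False
    then show ?thesis by (intro AE_I2) blast
  qed
  \<comment> \<open>Stages, nodes and tolerance indices range over countable types, so the
    exceptional sets combine into one null set.\<close>
  have "AE \<omega> in P. \<forall>t n i. t \<in> {2..msT d} \<and> node d (t - 1) n \<longrightarrow>
      infinite {k. \<not> ?gap \<omega> t n (1 / Suc i) k} \<longrightarrow>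
      infinite {k. sample_node (s \<omega>) k (t - 1) = n \<and> \<not> ?gap \<omega> t n (1 / Suc i) k}"
    unfolding AE_all_countable by (intro allI sampled)
  then show ?thesis
  proof eventually_elim
    case (elim \<omega>)
    interpret sreda_good_path d lam Q0 "s \<omega>" "xP \<omega>" "x \<omega>" "pg \<omega>" "Qc \<omega>"
      using path elim by (intro sreda_good_path.intro sreda_good_path_axioms.intro) blast+
    show ?case
      using gap_lim forward_value_lim lower_bound_lim accumulation_point_optimal by blast
  qed
qed

end
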